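(* Let $q\ge 1$ be fixed and let $\mathbf{\Sigma}$ be a fixed, known $q\times q$ positive definite matrix. For each $n\ge1$ let $\mathbf{X}_n$ be a (deterministic) $n\times p_n$ design matrix, let $\mathbf{B}_0=\mathbf{B}_{0n}\in\mathbb{R}^{p_n\times q}$ be the true coefficient matrix, and let the data be generated as $\mathbf{Y}_n=\mathbf{X}_n\mathbf{B}_0+\mathbf{E}_n$ with $\mathbf{E}_n\sim\mathcal{MN}_{n\times q}(\mathbf{O},\mathbf{I}_n,\mathbf{\Sigma})$; let $\mathbb{P}_0$ denote the distribution of $\{\mathbf{Y}_n\}_{n\ge1}$ under this true model. Let $\pi_n(\mathbf{B}_n)$ be any prior density on $\mathbb{R}^{p_n\times q}$ with distribution $\Pi_n$, and let $\Pi_n(\cdot\mid\mathbf{Y}_n)$ be the posterior under the likelihood $\mathbf{Y}_n\mid\mathbf{B}_n\sim\mathcal{MN}_{n\times q}(\mathbf{X}_n\mathbf{B}_n,\mathbf{I}_n,\mathbf{\Sigma})$. Assume: (A1) $p_n=o(n)$ and $p_n\le n$ for all $n\ge1$; (A2) there are constants $c_1,c_2$ with $0<c_1<\liminf_{n\to\infty}\lambda_{\min}(\mathbf{X}_n^\top\mathbf{X}_n/n)\le\limsup_{n\to\infty}\lambda_{\max}(\mathbf{X}_n^\top\mathbf{X}_n/n)<c_2<\infty$; (A3) there are constants $d_1,d_2$ with $0<d_1<\lambda_{\min}(\mathbf{\Sigma})\le\lambda_{\max}(\mathbf{\Sigma})<d_2<\infty$. Fix $\varepsilon>0$ and suppose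 there is $\rho>0$ such that for all $0<\Delta<\frac{\varepsilon^2c_1d_1^{1/2}}{48c_2^{1/2}d_2}$ and all $0<k<\frac{\varepsilon^2c_1}{32d_2}-\frac{3\Delta c_2^{1/2}}{2d_1^{1/2}}$, $$\Pi_n\Big(\mathbf{B}_n:\ \|\mathbf{B}_n-\mathbf{B}_0\|_F<\frac{\Delta}{n^{\rho/2}}\Big)>\exp(-kn)$$ for all sufficiently large $n$. Then $$\Pi_n\big(\mathbf{B}_n:\ \|\mathbf{B}_n-\mathbf{B}_0\|_F>\varepsilon\ \big|\ \mathbf{Y}_n\big)\to0\quad\text{almost surely }\mathbb{P}_0\text{ as }n\to\infty.$$
   Context: A random matrix $\mathbf{Y}\in\mathbb{R}^{a\times b}$ has the matrix-normal distribution $\mathcal{MN}_{a\times b}(\mathbf{M},\mathbf{U},\mathbf{V})$ (with $\mathbf{M}\in\mathbb{R}^{a\times b}$, $\mathbf{U}$, $\mathbf{V}$ positive definite of sizes $a\times a$, $b\times b$) if it has density $f(\mathbf{Y})=(2\pi)^{-ab/2}|\mathbf{U}|^{-b/2}|\mathbf{V}|^{-a/2}\exp\{-\tfrac12\mathrm{tr}[\mathbf{U}^{-1}(\mathbf{Y}-\mathbf{M})\mathbf{V}^{-1}(\mathbf{Y}-\mathbf{M})^\top]\}$. $\mathbf{O}$ denotes the zero matrix, $\|\cdot\|_F$ the Frobenius norm, and $\lambda_{\min},\lambda_{\max}$ the smallest and largest eigenvalues of a symmetric matrix. The number of predictors $p_n$ may grow with $n$. *)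

theory Defs
  imports "HOL-Probability.Probability" "HOL-Library.Landau_Symbols"
    "Jordan_Normal_Form.Matrix" "Jordan_Normal_Form.Determinant"
    "Jordan_Normal_Form.Char_Poly" "Jordan_Normal_Form.Gauss_Jordan_Elimination"
begin

definition mat_space :: "nat \<Rightarrow> nat \<Rightarrow> real mat measure" where
  "mat_space a b = embed_measure (PiM ({..<a} \<times> {..<b}) (\<lambda>_. lborel))
                                 (\<lambda>f. mat a b (\<lambda>ij. f ij))"

definition mat_trace :: "real mat \<Rightarrow> real" where
  "mat_trace A = (\<Sum>i<dim_row A. A $$ (i, i))"

definition mat_inv :: "real mat \<Rightarrow> real mat" where
  "mat_inv A = the (mat_inverse A)"

definition frob_norm :: "real mat \<Rightarrow> real" where
  "frob_norm A = sqrt (\<Sum>i<dim_row A. \<Sum>j<dim_col A. (A $$ (i, j))^2)"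

definition lambda_min :: "real mat \<Rightarrow> real" where
  "lambda_min A = Min {k. eigenvalue A k}"

definition lambda_max :: "real mat \<Rightarrow> real" where
  "lambda_max A = Max {k. eigenvalue A k}"

definition pos_def_mat :: "nat \<Rightarrow> real mat \<Rightarrow> bool" where
  "pos_def_mat m A \<longleftrightarrow> A \<in> carrier_mat m m \<and> transpose_mat A = A \<and>
     (\<forall>v \<in> carrier_vec m. v \<noteq> 0\<^sub>v m \<longrightarrow> v \<bullet> (A *\<^sub>v v) > 0)"

definition mn_density :: "real mat \<Rightarrow> real mat \<Rightarrow> real mat \<Rightarrow> real mat \<Rightarrow> real" where
  "mn_density M U V Y =
     (let a = dim_row M; b = dim_col M in
      (2 * pi) powr (- (real a * real b) / 2) * det U powr (- real b / 2) *
      det V powr (- real a / 2) *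
      exp (- 1/2 * mat_trace (mat_inv U * (Y - M) * mat_inv V * transpose_mat (Y - M))))"

definition prior_measure :: "nat \<Rightarrow> nat \<Rightarrow> (real mat \<Rightarrow> real) \<Rightarrow> real mat measure" where
  "prior_measure p q prior = density (mat_space p q) (\<lambda>B. ennreal (prior B))"

definition posterior_measure ::
  "real mat \<Rightarrow> real mat \<Rightarrow> nat \<Rightarrow> (real mat \<Rightarrow> real) \<Rightarrow> real mat \<Rightarrow> real mat measure" where
  "posterior_measure X S q prior Y =
     (let n = dim_row X; p = dim_col X;
          lik = (\<lambda>B. mn_density (X * B) (1\<^sub>m n) S Y);
          Z = (\<integral>\<^sup>+ B. ennreal (lik B) \<partial>prior_measure p q prior)
      in density (prior_measure p q prior) (\<lambda>B. ennreal (lik B) / Z))"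

end

theory Submission
  imports Defs
begin

text \<open>
  Write \<open>D = B - B\<^sub>0\<close>, \<open>C = \<Sigma>\<^sup>-\<^sup>1\<close> and let \<open>G = X\<^sup>T E C\<close> be the score at the truth. The likelihood
  ratio is \<open>exp (\<langle>G, D\<rangle> - Q D / 2)\<close>, where \<open>Q D = tr (X D C D\<^sup>T X\<^sup>T)\<close> lies between two multiples of
  \<open>n \<parallel>D\<parallel>\<^sup>2\<close>. Hence, once \<open>\<parallel>G\<parallel> \<le> \<delta> n\<close> for a small \<open>\<delta>\<close>, there is an \<open>\<eta> > 0\<close> such that the
  ratio is at most \<open>exp (- 4 \<eta> n)\<close> outside the \<open>\<epsilon>\<close>-ball, while the prior mass near \<open>B\<^sub>0\<close> keeps
  its average above \<open>exp (- 2 \<eta> n)\<close>.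

  For the bound on \<open>G\<close>, completing the square and translation invariance of Lebesgue measure give
  \<open>E exp \<langle>G, D\<rangle> = exp (Q D / 2) \<le> exp (L \<parallel>D\<parallel>\<^sup>2 / 2)\<close> with \<open>L\<close> of order \<open>n\<close>. Averaging this over an
  independent Gaussian \<open>D\<close> yields \<open>E exp (\<parallel>G\<parallel>\<^sup>2 / (4 L)) \<le> 2\<^bsup>pq/2\<^esup>\<close>, and as \<open>p = o(n)\<close> the events
  \<open>\<parallel>G\<parallel> > \<delta> n\<close> have summable probabilities whatever the dependence between different \<open>n\<close>.
\<close>

section \<open>Quadratic forms and eigenvalues of real symmetric matrices\<close>

unbundle no inner_syntax

lemma scalar_prod_self_nonneg [simp]: "0 \<le> v \<bullet> (v :: real vec)"
  by (auto simp: scalar_prod_def intro: sum_nonneg)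

lemma scalar_prod_Cauchy_Schwarz:
  assumes "(v :: real vec) \<in> carrier_vec n" "w \<in> carrier_vec n"
  shows "(v \<bullet> w)\<^sup>2 \<le> (v \<bullet> v) * (w \<bullet> w)"
  using assms Cauchy_Schwarz_ineq_sum[of "($) v" "($) w" "{0..<n}"]
  by (simp add: scalar_prod_def power2_eq_square)

lemma mult_mat_vec_bounded:
  assumes A_dim: "(A :: real mat) \<in> carrier_mat m n"
  obtains K where "K > 0" "\<And>v. v \<in> carrier_vec n \<Longrightarrow> (A *\<^sub>v v) \<bullet> (A *\<^sub>v v) \<le> K * (v \<bullet> v)"
proof
  let ?K = "\<Sum>i\<in>{0..<m}. row A i \<bullet> row A i"
  show "?K + 1 > 0" by (intro add_nonneg_pos sum_nonneg) auto
  fix v :: "real vec" assume v_dim: "v \<in> carrier_vec n"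
  have "(A *\<^sub>v v) \<bullet> (A *\<^sub>v v) = (\<Sum>i\<in>{0..<m}. (row A i \<bullet> v)\<^sup>2)"
    using A_dim by (simp add: scalar_prod_def[of "A *\<^sub>v v"] power2_eq_square)
  also have "\<dots> \<le> (\<Sum>i\<in>{0..<m}. (row A i \<bullet> row A i) * (v \<bullet> v))"
    by (intro sum_mono scalar_prod_Cauchy_Schwarz) (use A_dim v_dim in auto)
  also have "\<dots> = ?K * (v \<bullet> v)" by (simp add: sum_distrib_right)
  also have "\<dots> \<le> (?K + 1) * (v \<bullet> v)" by (intro mult_right_mono) auto
  finally show "(A *\<^sub>v v) \<bullet> (A *\<^sub>v v) \<le> (?K + 1) * (v \<bullet> v)" .
qed

definition rayleigh_within :: "real mat \<Rightarrow> real \<Rightarrow> real \<Rightarrow> bool" where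
  "rayleigh_within A a b \<longleftrightarrow> (\<forall>v\<in>carrier_vec (dim_row A).
     a * (v \<bullet> v) \<le> v \<bullet> (A *\<^sub>v v) \<and> v \<bullet> (A *\<^sub>v v) \<le> b * (v \<bullet> v))"

lemma rayleigh_withinI:
  assumes "A \<in> carrier_mat n n"
    and "\<And>v. v \<in> carrier_vec n \<Longrightarrow> a * (v \<bullet> v) \<le> v \<bullet> (A *\<^sub>v v)"
    and "\<And>v. v \<in> carrier_vec n \<Longrightarrow> v \<bullet> (A *\<^sub>v v) \<le> b * (v \<bullet> v)"
  shows "rayleigh_within A a b"
  using assms by (simp add: rayleigh_within_def)

lemma rayleigh_withinD:
  assumes "rayleigh_within A a b" "A \<in> carrier_mat n n" "v \<in> carrier_vec n"
  shows "a * (v \<bullet> v) \<le> v \<bullet> (A *\<^sub>v v)" and "v \<bullet> (A *\<^sub>v v) \<le> b * (v \<bullet> v)"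
  using assms by (simp_all add: rayleigh_within_def)

lemma rayleigh_within_mono:
  assumes "rayleigh_within A a b" "a' \<le> a" "b \<le> b'"
  shows "rayleigh_within A a' b'"
proof -
  have "a' * (v \<bullet> v) \<le> a * (v \<bullet> v)" "b * (v \<bullet> v) \<le> b' * (v \<bullet> v)" for v :: "real vec"
    using assms by (auto intro: mult_right_mono)
  then show ?thesis
    using assms(1) unfolding rayleigh_within_def by (meson order_trans)
qed

lemma rayleigh_within_uminus:
  assumes "A \<in> carrier_mat n n"
  shows "rayleigh_within (- A) (- b) (- a) \<longleftrightarrow> rayleigh_within A a b"
  using assms by (auto simp: rayleigh_within_def)

lemma rayleigh_within_smult:
  assumes "A \<in> carrier_mat n n" "k > 0"
  shows "rayleigh_within (k \<cdot>\<^sub>m A) a b \<longleftrightarrow> rayleigh_within A (a / k) (b / k)"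
proof -
  have "(k \<cdot>\<^sub>m A) *\<^sub>v v = k \<cdot>\<^sub>v (A *\<^sub>v v)" if "v \<in> carrier_vec n" for v
    using assms that by (intro eq_vecI) auto
  then show ?thesis
    using assms by (simp add: rayleigh_within_def field_simps)
qed

lemma char_matrix_mult_vec:
  assumes "(A :: 'a :: field mat) \<in> carrier_mat n n" "v \<in> carrier_vec n"
  shows "char_matrix A e *\<^sub>v v = A *\<^sub>v v - e \<cdot>\<^sub>v v"
  using assms unfolding char_matrix_def
  by (intro eq_vecI) (auto simp: add_scalar_prod_distrib[of _ n])

lemma rayleigh_within_char_matrix:
  assumes "A \<in> carrier_mat n n"
  shows "rayleigh_within (char_matrix A e) a b \<longleftrightarrow> rayleigh_within A (a + e) (b + e)"
proof -
  have "v \<bullet> (char_matrix A e *\<^sub>v v) = v \<bullet> (A *\<^sub>v v) - e * (v \<bullet> v)" if "v \<in> carrier_vec n" for v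
    using assms that by (simp add: char_matrix_mult_vec[of _ n] scalar_prod_minus_distrib[of _ n])
  moreover have "dim_row A = n" "dim_row (char_matrix A e) = n"
    using assms carrier_matD(1)[OF char_matrix_closed[OF assms]] by auto
  ultimately show ?thesis
    by (simp add: rayleigh_within_def distrib_right le_diff_eq diff_le_eq)
qed

lemma transpose_char_matrix:
  assumes "(A :: 'a :: field mat) \<in> carrier_mat n n"
  shows "(char_matrix A e)\<^sup>T = char_matrix (A\<^sup>T) e"
  using assms by (intro eq_matI) (auto simp: char_matrix_def)

lemma rayleigh_within_exists:
  assumes A_dim: "A \<in> carrier_mat n n"
  obtains K where "K > 0" "rayleigh_within A (- K) K"
proof -
  obtain K where K: "K > 0" "\<And>v. v \<in> carrier_vec n \<Longrightarrow> (A *\<^sub>v v) \<bullet> (A *\<^sub>v v) \<le> K * (v \<bullet> v)"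
    using mult_mat_vec_bounded[OF A_dim] by blast
  have bound: "\<bar>v \<bullet> (A *\<^sub>v v)\<bar> \<le> sqrt K * (v \<bullet> v)" if v_dim: "v \<in> carrier_vec n" for v
  proof -
    have "(v \<bullet> (A *\<^sub>v v))\<^sup>2 \<le> (v \<bullet> v) * ((A *\<^sub>v v) \<bullet> (A *\<^sub>v v))"
      using A_dim v_dim by (intro scalar_prod_Cauchy_Schwarz) auto
    also have "\<dots> \<le> (v \<bullet> v) * (K * (v \<bullet> v))"
      by (intro mult_left_mono K(2) v_dim) simp
    also have "\<dots> = (sqrt K * (v \<bullet> v))\<^sup>2"
      using K(1) by (simp add: power2_eq_square)
    finally show ?thesis
      using K(1) by (simp add: abs_le_square_iff[symmetric] abs_mult)
  qed
  show ?thesis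
  proof (rule that)
    show "sqrt K > 0" using K(1) by simp
    show "rayleigh_within A (- sqrt K) (sqrt K)"
      by (rule rayleigh_withinI[OF A_dim]) (use bound in \<open>force simp: abs_le_iff\<close>)+
  qed
qed

lemma symmetric_form_commute:
  assumes "(A :: real mat) \<in> carrier_mat n n" "A\<^sup>T = A"
    and "v \<in> carrier_vec n" "w \<in> carrier_vec n"
  shows "v \<bullet> (A *\<^sub>v w) = w \<bullet> (A *\<^sub>v v)"
  using transpose_vec_mult_scalar[of A n n w v] assms
  by (metis mult_mat_vec_carrier comm_scalar_prod)

lemma psd_image_norm_le:
  assumes A_sym: "A \<in> carrier_mat n n" "A\<^sup>T = A"
    and A_bounds: "rayleigh_within A 0 L" and L_pos: "L > 0" and v_dim: "v \<in> carrier_vec n"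
  shows "(A *\<^sub>v v) \<bullet> (A *\<^sub>v v) \<le> L * (v \<bullet> (A *\<^sub>v v))"
proof -
  define w where "w = (1 / L) \<cdot>\<^sub>v (A *\<^sub>v v)"
  have w_dim: "w \<in> carrier_vec n" and image_dim: "A *\<^sub>v v \<in> carrier_vec n" "A *\<^sub>v w \<in> carrier_vec n"
    using A_sym v_dim by (auto simp: w_def)
  have cross_form: "v \<bullet> (A *\<^sub>v w) = (1 / L) * ((A *\<^sub>v v) \<bullet> (A *\<^sub>v v))"
      "w \<bullet> (A *\<^sub>v v) = v \<bullet> (A *\<^sub>v w)"
    using symmetric_form_commute[OF A_sym v_dim w_dim] image_dim by (simp_all add: w_def)
  have form_w_le: "w \<bullet> (A *\<^sub>v w) \<le> (1 / L) * ((A *\<^sub>v v) \<bullet> (A *\<^sub>v v))"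
    using rayleigh_withinD(2)[OF A_bounds A_sym(1) w_dim] L_pos image_dim(1) by (simp add: w_def)
  have "0 \<le> (v - w) \<bullet> (A *\<^sub>v (v - w))"
    using rayleigh_withinD(1)[OF A_bounds A_sym(1), of "v - w"] v_dim w_dim by simp
  also have "\<dots> = v \<bullet> (A *\<^sub>v v) - 2 * (v \<bullet> (A *\<^sub>v w)) + w \<bullet> (A *\<^sub>v w)"
    using v_dim w_dim image_dim cross_form(2)
    by (simp add: mult_minus_distrib_mat_vec[OF A_sym(1)] minus_scalar_prod_distrib[of _ n]
        scalar_prod_minus_distrib[of _ n])
  finally show ?thesis
    using form_w_le cross_form(1) L_pos by (simp add: field_simps)
qed

lemma mat_inv_of_det_nonzero:
  assumes A_dim: "A \<in> carrier_mat n n" and "det A \<noteq> 0"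
  shows "mat_inv A \<in> carrier_mat n n" "A * mat_inv A = 1\<^sub>m n" "mat_inv A * A = 1\<^sub>m n"
proof -
  have "mat_inverse A \<noteq> None"
    using mat_inverse(1)[OF A_dim, of "()"] det_non_zero_imp_unit[OF A_dim assms(2), of "()"]
    by blast
  then obtain B where "mat_inverse A = Some B" by blast
  then show "mat_inv A \<in> carrier_mat n n" "A * mat_inv A = 1\<^sub>m n" "mat_inv A * A = 1\<^sub>m n"
    using mat_inverse(2)[OF A_dim] by (auto simp: mat_inv_def)
qed

lemma psd_invertible_coercive:
  assumes A_sym: "A \<in> carrier_mat n n" "A\<^sup>T = A"
    and A_bounds: "rayleigh_within A 0 L" and L_pos: "L > 0" and det_nonzero: "det A \<noteq> 0"
  obtains \<kappa> where "\<kappa> > 0" "rayleigh_within A \<kappa> L"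
proof -
  note inv = mat_inv_of_det_nonzero[OF A_sym(1) det_nonzero]
  obtain K where K: "K > 0"
    "\<And>w. w \<in> carrier_vec n \<Longrightarrow> (mat_inv A *\<^sub>v w) \<bullet> (mat_inv A *\<^sub>v w) \<le> K * (w \<bullet> w)"
    using mult_mat_vec_bounded[OF inv(1)] by blast
  show ?thesis
  proof (rule that)
    show "1 / (K * L) > 0" using K L_pos by simp
    show "rayleigh_within A (1 / (K * L)) L"
    proof (rule rayleigh_withinI[OF A_sym(1) _ rayleigh_withinD(2)[OF A_bounds A_sym(1)]])
      fix v :: "real vec" assume v_dim: "v \<in> carrier_vec n"
      have "v = mat_inv A *\<^sub>v (A *\<^sub>v v)"
        using inv A_sym v_dim by (metis assoc_mult_mat_vec one_mult_mat_vec)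
      then have "v \<bullet> v \<le> K * ((A *\<^sub>v v) \<bullet> (A *\<^sub>v v))"
        using K(2)[of "A *\<^sub>v v"] A_sym v_dim by simp
      also have "\<dots> \<le> K * (L * (v \<bullet> (A *\<^sub>v v)))"
        using K(1) by (intro mult_left_mono psd_image_norm_le[OF A_sym A_bounds L_pos v_dim]) auto
      finally show "1 / (K * L) * (v \<bullet> v) \<le> v \<bullet> (A *\<^sub>v v)"
        using K(1) L_pos by (simp add: field_simps)
    qed
  qed
qed

lemma rayleigh_greatest_lower_bound:
  assumes A_dim: "A \<in> carrier_mat n n" and n_pos: "n > 0" and A_bounds: "rayleigh_within A a b"
  obtains m where "rayleigh_within A m b" "\<And>t. rayleigh_within A t b \<Longrightarrow> t \<le> m"
proof -
  let ?S = "{t. rayleigh_within A t b}"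
  have unit_vec_norm: "unit_vec n 0 \<bullet> unit_vec n 0 = (1 :: real)" using n_pos by simp
  have S_bdd: "bdd_above ?S"
  proof (rule bdd_aboveI)
    fix t assume "t \<in> ?S"
    then show "t \<le> unit_vec n 0 \<bullet> (A *\<^sub>v unit_vec n 0)"
      using rayleigh_withinD(1)[of A t b n "unit_vec n 0"] A_dim unit_vec_norm by simp
  qed
  have "rayleigh_within A (Sup ?S) b"
  proof (rule rayleigh_withinI[OF A_dim _ rayleigh_withinD(2)[OF A_bounds A_dim]])
    fix v :: "real vec" assume v_dim: "v \<in> carrier_vec n"
    show "Sup ?S * (v \<bullet> v) \<le> v \<bullet> (A *\<^sub>v v)"
    proof (cases "v \<bullet> v = 0")
      case True
      then show ?thesis using rayleigh_withinD(1)[OF A_bounds A_dim v_dim] by simp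
    next
      case False
      then have v_pos: "v \<bullet> v > 0" using scalar_prod_self_nonneg[of v] by linarith
      have "Sup ?S \<le> (v \<bullet> (A *\<^sub>v v)) / (v \<bullet> v)"
        using A_bounds v_pos rayleigh_withinD(1)[OF _ A_dim v_dim]
        by (intro cSup_least) (auto simp: pos_le_divide_eq)
      then show ?thesis using v_pos by (simp add: pos_le_divide_eq)
    qed
  qed
  then show ?thesis using cSup_upper[OF _ S_bdd] by (intro that[of "Sup ?S"]) auto
qed

text \<open>
  No compactness of the sphere is needed: if \<open>m\<close> is the largest shift for which \<open>A - m\<close> is positive
  semidefinite, then \<open>A - m\<close> is singular, since otherwise it is coercive and \<open>m\<close> could be increased.
\<close>

lemma symmetric_least_eigenvalue:
  assumes A_sym: "A \<in> carrier_mat n n" "A\<^sup>T = A" and n_pos: "n > 0"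
  obtains m K where "eigenvalue A m" "rayleigh_within A m K"
proof -
  obtain K where K: "K > 0" "rayleigh_within A (- K) K"
    using rayleigh_within_exists[OF A_sym(1)] by blast
  obtain m where m: "rayleigh_within A m K" "\<And>t. rayleigh_within A t K \<Longrightarrow> t \<le> m"
    using rayleigh_greatest_lower_bound[OF A_sym(1) n_pos K(2)] by blast
  let ?B = "char_matrix A m" and ?L = "max 1 (K - m)"
  have B: "?B \<in> carrier_mat n n" "?B\<^sup>T = ?B" "rayleigh_within ?B 0 ?L" "?L > 0"
    using A_sym rayleigh_within_mono[OF m(1), of m "?L + m"]
    by (simp_all add: transpose_char_matrix rayleigh_within_char_matrix[OF A_sym(1)])
  have "det ?B = 0"
  proof (rule ccontr)
    assume "det ?B \<noteq> 0"
    then obtain \<kappa> where \<kappa>: "\<kappa> > 0" "rayleigh_within ?B \<kappa> ?L"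
      using psd_invertible_coercive[OF B] by blast
    then have "rayleigh_within A (\<kappa> + m) K"
      using m(1) unfolding rayleigh_within_char_matrix[OF A_sym(1)]
      by (simp add: rayleigh_within_def)
    then have "\<kappa> + m \<le> m" by (rule m(2))
    with \<kappa>(1) show False by simp
  qed
  then have "eigenvalue A m" using eigenvalue_det[OF A_sym(1)] by simp
  with m(1) show ?thesis by (rule that[rotated])
qed

lemma finite_eigenvalues:
  assumes "(A :: 'a :: field mat) \<in> carrier_mat n n"
  shows "finite {k. eigenvalue A k}"
proof -
  have "char_poly A \<noteq> 0" using degree_monic_char_poly[OF assms] by auto
  then show ?thesis
    unfolding eigenvalue_root_char_poly[OF assms] by (rule poly_roots_finite)
qed

lemma eigenvalue_uminus:
  assumes A_dim: "(A :: 'a :: field mat) \<in> carrier_mat n n"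
  shows "eigenvalue (- A) k \<longleftrightarrow> eigenvalue A (- k)"
proof -
  have "eigenvector (- A) v k \<longleftrightarrow> eigenvector A v (- k)" for v
    using A_dim
    by (cases "v \<in> carrier_vec n") (auto simp: eigenvector_def vec_eq_iff minus_equation_iff)
  then show ?thesis
    by (simp add: eigenvalue_def)
qed

lemma rayleigh_within_lambda:
  assumes A_sym: "A \<in> carrier_mat n n" "A\<^sup>T = A"
  shows "rayleigh_within A (lambda_min A) (lambda_max A)"
proof (cases "n = 0")
  case True
  then show ?thesis using A_sym by (auto simp: rayleigh_within_def scalar_prod_def)
next
  case False
  have uminus_sym: "- A \<in> carrier_mat n n" "(- A)\<^sup>T = - A"
    using A_sym by (auto simp: transpose_uminus)
  obtain m K where m: "eigenvalue A m" "rayleigh_within A m K"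
    using symmetric_least_eigenvalue[OF A_sym] False by auto
  obtain m' K' where m': "eigenvalue (- A) m'" "rayleigh_within (- A) m' K'"
    using symmetric_least_eigenvalue[OF uminus_sym] False by auto
  have "rayleigh_within A m (- m')"
    using m(2) m'(2) rayleigh_within_uminus[OF A_sym(1), of "- m'" "- K'"]
    by (simp add: rayleigh_within_def)
  then show ?thesis
  proof (rule rayleigh_within_mono)
    show "lambda_min A \<le> m"
      unfolding lambda_min_def using finite_eigenvalues[OF A_sym(1)] m(1) by simp
    show "- m' \<le> lambda_max A"
      unfolding lambda_max_def
      using finite_eigenvalues[OF A_sym(1)] m'(1) eigenvalue_uminus[OF A_sym(1)] by simp
  qed
qed

lemma rayleigh_within_gram:
  assumes X_dim: "X \<in> carrier_mat n p" and n_pos: "n > 0"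
    and "a \<le> lambda_min ((1 / real n) \<cdot>\<^sub>m (X\<^sup>T * X))"
    and "lambda_max ((1 / real n) \<cdot>\<^sub>m (X\<^sup>T * X)) \<le> b"
  shows "rayleigh_within (X\<^sup>T * X) (real n * a) (real n * b)"
proof -
  let ?G = "X\<^sup>T * X"
  have gram_sym: "?G \<in> carrier_mat p p" "?G\<^sup>T = ?G"
    using X_dim by (auto simp: transpose_mult[of _ p n])
  have "((1 / real n) \<cdot>\<^sub>m ?G)\<^sup>T = (1 / real n) \<cdot>\<^sub>m ?G\<^sup>T"
    by (rule eq_matI) auto
  then have "rayleigh_within ((1 / real n) \<cdot>\<^sub>m ?G) a b"
    using gram_sym assms(3,4)
    by (intro rayleigh_within_mono[OF rayleigh_within_lambda[of _ p]]) auto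
  then show ?thesis
    using rayleigh_within_smult[OF gram_sym(1), of "1 / real n" a b] n_pos
    by (simp add: mult.commute)
qed

lemma pos_def_mat_det_nonzero:
  assumes S_pd: "pos_def_mat q S"
  shows "det S \<noteq> 0"
proof
  assume "det S = 0"
  then obtain v where "v \<in> carrier_vec q" "v \<noteq> 0\<^sub>v q" "S *\<^sub>v v = 0\<^sub>v q"
    using det_0_iff_vec_prod_zero[of S q] S_pd by (auto simp: pos_def_mat_def)
  then show False using S_pd by (force simp: pos_def_mat_def)
qed

lemma pos_def_mat_inverse:
  assumes S_pd: "pos_def_mat q S"
  shows "mat_inv S \<in> carrier_mat q q" "S * mat_inv S = 1\<^sub>m q" "(mat_inv S)\<^sup>T = mat_inv S"
proof -
  have S_sym: "S \<in> carrier_mat q q" "S\<^sup>T = S" using S_pd by (auto simp: pos_def_mat_def)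
  note inv = mat_inv_of_det_nonzero[OF S_sym(1) pos_def_mat_det_nonzero[OF S_pd]]
  then show "mat_inv S \<in> carrier_mat q q" "S * mat_inv S = 1\<^sub>m q" by simp_all
  have "(mat_inv S)\<^sup>T * S = 1\<^sub>m q"
    using transpose_mult[OF S_sym(1) inv(1)] inv(2) S_sym(2) by simp
  then have "(mat_inv S)\<^sup>T * (S * mat_inv S) = mat_inv S"
    using inv S_sym by (subst assoc_mult_mat[of _ q q _ q _ q, symmetric]) auto
  then show "(mat_inv S)\<^sup>T = mat_inv S"
    using inv by simp
qed

lemma rayleigh_within_mat_inv:
  assumes S_pd: "pos_def_mat q S" and S_bounds: "rayleigh_within S a b" and a_pos: "a > 0"
    and b_pos: "b > 0"
  shows "rayleigh_within (mat_inv S) (1 / b) (1 / a)"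
proof -
  have S_sym: "S \<in> carrier_mat q q" "S\<^sup>T = S" using S_pd by (auto simp: pos_def_mat_def)
  note S_inv = pos_def_mat_inverse[OF S_pd]
  have S_psd: "rayleigh_within S 0 b"
    using a_pos by (intro rayleigh_within_mono[OF S_bounds]) auto
  have image: "\<exists>u\<in>carrier_vec q. mat_inv S *\<^sub>v v = u \<and> v = S *\<^sub>v u"
    if v_dim: "v \<in> carrier_vec q" for v
    using S_inv S_sym v_dim by (metis assoc_mult_mat_vec mult_mat_vec_carrier one_mult_mat_vec)
  show ?thesis
  proof (rule rayleigh_withinI[OF S_inv(1)])
    fix v :: "real vec" assume v_dim: "v \<in> carrier_vec q"
    obtain u where u: "u \<in> carrier_vec q" "mat_inv S *\<^sub>v v = u" "v = S *\<^sub>v u"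
      using image[OF v_dim] by blast
    have form_eq: "v \<bullet> (mat_inv S *\<^sub>v v) = u \<bullet> v" using comm_scalar_prod[OF u(1) v_dim] u(2) by simp
    show "1 / b * (v \<bullet> v) \<le> v \<bullet> (mat_inv S *\<^sub>v v)"
      using psd_image_norm_le[OF S_sym S_psd b_pos u(1)] b_pos unfolding form_eq u(3)[symmetric]
      by (simp add: field_simps)
    have "0 \<le> (v - a \<cdot>\<^sub>v u) \<bullet> (v - a \<cdot>\<^sub>v u)" by simp
    also have "\<dots> = v \<bullet> v - 2 * a * (u \<bullet> v) + a * (a * (u \<bullet> u))"
      using u(1) v_dim comm_scalar_prod[OF u(1) v_dim]
      by (simp add: minus_scalar_prod_distrib[of _ q] scalar_prod_minus_distrib[of _ q]
          algebra_simps)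
    also have "\<dots> \<le> v \<bullet> v - 2 * a * (u \<bullet> v) + a * (u \<bullet> v)"
      using rayleigh_withinD(1)[OF S_bounds S_sym(1) u(1)] a_pos u(3) by simp
    finally show "v \<bullet> (mat_inv S *\<^sub>v v) \<le> 1 / a * (v \<bullet> v)"
      using a_pos unfolding form_eq by (simp add: field_simps)
  qed
qed

section \<open>The Frobenius inner product\<close>

definition frob_inner :: "real mat \<Rightarrow> real mat \<Rightarrow> real" where
  "frob_inner A B = (\<Sum>x\<in>{..<dim_row A} \<times> {..<dim_col A}. A $$ x * B $$ x)"

lemma frob_inner_rows:
  assumes "A \<in> carrier_mat a b" "B \<in> carrier_mat a b"
  shows "frob_inner A B = (\<Sum>i<a. row A i \<bullet> row B i)"
  using assms
  by (simp add: frob_inner_def scalar_prod_def lessThan_atLeast0 sum.cartesian_product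
      case_prod_unfold)

lemma frob_inner_transpose:
  assumes "A \<in> carrier_mat a b" "B \<in> carrier_mat a b"
  shows "frob_inner (A\<^sup>T) (B\<^sup>T) = frob_inner A B"
  unfolding frob_inner_def
  by (rule sum.reindex_bij_witness[of _ prod.swap prod.swap]) (use assms in auto)

lemma frob_inner_cols:
  assumes "A \<in> carrier_mat a b" "B \<in> carrier_mat a b"
  shows "frob_inner A B = (\<Sum>j<b. col A j \<bullet> col B j)"
  using frob_inner_rows[of "A\<^sup>T" b a "B\<^sup>T"] frob_inner_transpose[OF assms] assms
  by simp

lemma mat_trace_mult_transpose:
  assumes "A \<in> carrier_mat a b" "B \<in> carrier_mat a b"
  shows "mat_trace (A * B\<^sup>T) = frob_inner A B"
  using assms by (simp add: mat_trace_def frob_inner_rows[OF assms])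

lemma frob_inner_commute:
  assumes "A \<in> carrier_mat a b" "B \<in> carrier_mat a b"
  shows "frob_inner A B = frob_inner B A"
  using assms by (simp add: frob_inner_def mult.commute)

lemma frob_inner_diff_left:
  assumes "A \<in> carrier_mat a b" "B \<in> carrier_mat a b"
  shows "frob_inner (A - B) Z = frob_inner A Z - frob_inner B Z"
  using assms
  by (auto simp: frob_inner_def sum_subtractf[symmetric] left_diff_distrib intro!: sum.cong)

lemma frob_inner_diff_right:
  assumes "A \<in> carrier_mat a b" "B \<in> carrier_mat a b" "Z \<in> carrier_mat a b"
  shows "frob_inner Z (A - B) = frob_inner Z A - frob_inner Z B"
  using assms frob_inner_diff_left[OF assms(1,2), of Z]
  by (simp add: frob_inner_commute[of Z a b] minus_carrier_mat)

lemma frob_inner_mult_left: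
  assumes X_dim: "X \<in> carrier_mat n p" and D_dim: "D \<in> carrier_mat p q"
    and Z_dim: "Z \<in> carrier_mat n q"
  shows "frob_inner (X * D) Z = frob_inner D (X\<^sup>T * Z)"
proof -
  have "col (X * D) j \<bullet> col Z j = col D j \<bullet> col (X\<^sup>T * Z) j" if "j < q" for j
    using transpose_vec_mult_scalar[of "X\<^sup>T" p n "col Z j" "col D j"] X_dim D_dim Z_dim that
    by (simp add: mult_mat_vec_def)
  then show ?thesis
    using X_dim D_dim Z_dim
    by (simp add: frob_inner_cols[of _ n q] frob_inner_cols[of _ p q] del: col_mult)
qed

lemma frob_inner_mult_right:
  assumes Y_dim: "Y \<in> carrier_mat n p" and C_dim: "C \<in> carrier_mat p q"
    and Z_dim: "Z \<in> carrier_mat n q"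
  shows "frob_inner (Y * C) Z = frob_inner Y (Z * C\<^sup>T)"
proof -
  have "frob_inner (Y * C) Z = frob_inner (C\<^sup>T * Y\<^sup>T) (Z\<^sup>T)"
    using frob_inner_transpose[of "Y * C" n q Z] Y_dim C_dim Z_dim
    by (simp add: transpose_mult[OF Y_dim C_dim])
  also have "\<dots> = frob_inner (Y\<^sup>T) (C * Z\<^sup>T)"
    using Y_dim C_dim Z_dim by (subst frob_inner_mult_left[of _ q p]) auto
  also have "\<dots> = frob_inner Y (Z * C\<^sup>T)"
    using frob_inner_transpose[of Y n p "Z * C\<^sup>T"] Y_dim C_dim Z_dim
    by (simp add: transpose_mult[of Z n q])
  finally show ?thesis .
qed

lemma frob_inner_self: "frob_inner A A = (frob_norm A)\<^sup>2"
proof -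
  have "(frob_norm A)\<^sup>2 = (\<Sum>i<dim_row A. \<Sum>j<dim_col A. (A $$ (i, j))\<^sup>2)"
    unfolding frob_norm_def by (rule real_sqrt_pow2) (intro sum_nonneg, simp)
  then show ?thesis
    by (auto simp: frob_inner_def sum.cartesian_product power2_eq_square intro!: sum.cong)
qed

lemma frob_norm_sq:
  assumes "A \<in> carrier_mat a b"
  shows "(frob_norm A)\<^sup>2 = (\<Sum>x\<in>{..<a} \<times> {..<b}. (A $$ x)\<^sup>2)"
  using assms unfolding frob_inner_self[symmetric] frob_inner_def by (simp add: power2_eq_square)

lemma frob_norm_nonneg [simp]: "frob_norm A \<ge> 0"
  unfolding frob_norm_def by (intro real_sqrt_ge_zero sum_nonneg) simp

lemma frob_norm_transpose:
  assumes "A \<in> carrier_mat a b"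
  shows "frob_norm (A\<^sup>T) = frob_norm A"
  using frob_inner_transpose[OF assms assms] by (simp add: frob_inner_self power2_eq_iff_nonneg)

lemma frob_inner_Cauchy_Schwarz:
  assumes "A \<in> carrier_mat a b" "B \<in> carrier_mat a b"
  shows "\<bar>frob_inner A B\<bar> \<le> frob_norm A * frob_norm B"
proof -
  have "(frob_inner A B)\<^sup>2 \<le> frob_inner A A * frob_inner B B"
    using Cauchy_Schwarz_ineq_sum[of "($$) A" "($$) B" "{..<a} \<times> {..<b}"] assms
    by (simp add: frob_inner_def power2_eq_square)
  also have "\<dots> = (frob_norm A * frob_norm B)\<^sup>2"
    by (simp add: frob_inner_self power_mult_distrib)
  finally show ?thesis
    by (simp add: abs_le_square_iff[symmetric])
qed

lemma rayleigh_within_frob: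
  assumes A_bounds: "rayleigh_within A a b" and A_dim: "A \<in> carrier_mat p p"
    and D_dim: "D \<in> carrier_mat p q"
  shows "a * (frob_norm D)\<^sup>2 \<le> frob_inner D (A * D)"
    and "frob_inner D (A * D) \<le> b * (frob_norm D)\<^sup>2"
proof -
  have form_cols: "frob_inner D (A * D) = (\<Sum>j<q. col D j \<bullet> (A *\<^sub>v col D j))"
    using A_dim D_dim by (simp add: frob_inner_cols[of _ p q] mult_mat_vec_def)
  have norm_cols: "(frob_norm D)\<^sup>2 = (\<Sum>j<q. col D j \<bullet> col D j)"
    using D_dim by (simp add: frob_inner_self[symmetric] frob_inner_cols)
  show "a * (frob_norm D)\<^sup>2 \<le> frob_inner D (A * D)" "frob_inner D (A * D) \<le> b * (frob_norm D)\<^sup>2"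
    unfolding form_cols norm_cols sum_distrib_left using D_dim
    by (auto intro!: sum_mono rayleigh_withinD[OF A_bounds A_dim])
qed

section \<open>The Mahalanobis form of the noise covariance\<close>

definition mahalanobis :: "real mat \<Rightarrow> real mat \<Rightarrow> real" where
  "mahalanobis S Y = frob_inner (Y * mat_inv S) Y"

lemma mahalanobis_diff:
  assumes S_pd: "pos_def_mat q S" and Y_dim: "Y \<in> carrier_mat n q" and H_dim: "H \<in> carrier_mat n q"
  shows "mahalanobis S (Y - H)
    = mahalanobis S Y - 2 * frob_inner H (Y * mat_inv S) + mahalanobis S H"
proof -
  note S_inv = pos_def_mat_inverse(1,3)[OF S_pd]
  have "(Y - H) * mat_inv S = Y * mat_inv S - H * mat_inv S"
    by (rule minus_mult_distrib_mat[OF Y_dim H_dim S_inv(1)])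
  moreover have "frob_inner (H * mat_inv S) Y = frob_inner H (Y * mat_inv S)"
    using frob_inner_mult_right[OF H_dim S_inv(1) Y_dim] S_inv(2) by simp
  moreover have "frob_inner (Y * mat_inv S) H = frob_inner H (Y * mat_inv S)"
    using Y_dim H_dim S_inv(1) by (intro frob_inner_commute) auto
  ultimately show ?thesis
    using Y_dim H_dim S_inv(1) unfolding mahalanobis_def
    by (simp add: frob_inner_diff_left[of _ n q] frob_inner_diff_right[of _ n q] minus_carrier_mat)
qed

lemma mahalanobis_within:
  assumes S_pd: "pos_def_mat q S" and inv_bounds: "rayleigh_within (mat_inv S) a b"
    and Y_dim: "Y \<in> carrier_mat n q"
  shows "a * (frob_norm Y)\<^sup>2 \<le> mahalanobis S Y" and "mahalanobis S Y \<le> b * (frob_norm Y)\<^sup>2"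
proof -
  note S_inv = pos_def_mat_inverse(1,3)[OF S_pd]
  have YT_dim: "Y\<^sup>T \<in> carrier_mat q n" using Y_dim by simp
  have "mahalanobis S Y = frob_inner (mat_inv S * Y\<^sup>T) (Y\<^sup>T)"
    unfolding mahalanobis_def using frob_inner_transpose[of "Y * mat_inv S" n q Y] Y_dim S_inv
    by (simp add: transpose_mult[OF Y_dim S_inv(1)])
  also have "\<dots> = frob_inner (Y\<^sup>T) (mat_inv S * Y\<^sup>T)"
    using S_inv(1) YT_dim by (intro frob_inner_commute) auto
  finally show "a * (frob_norm Y)\<^sup>2 \<le> mahalanobis S Y" "mahalanobis S Y \<le> b * (frob_norm Y)\<^sup>2"
    using rayleigh_within_frob[OF inv_bounds S_inv(1) YT_dim] frob_norm_transpose[OF Y_dim]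
    by simp_all
qed

text \<open>The form \<open>D \<mapsto> mahalanobis S (X * D)\<close> is the Fisher information of the coefficient matrix.\<close>

definition information_within :: "real mat \<Rightarrow> real mat \<Rightarrow> real \<Rightarrow> real \<Rightarrow> bool" where
  "information_within S X a b \<longleftrightarrow> (\<forall>D\<in>carrier_mat (dim_col X) (dim_col S).
     a * (frob_norm D)\<^sup>2 \<le> mahalanobis S (X * D) \<and> mahalanobis S (X * D) \<le> b * (frob_norm D)\<^sup>2)"

lemma information_withinD:
  assumes "pos_def_mat q S" "X \<in> carrier_mat n p" "information_within S X a b" "D \<in> carrier_mat p q"
  shows "a * (frob_norm D)\<^sup>2 \<le> mahalanobis S (X * D)"
    and "mahalanobis S (X * D) \<le> b * (frob_norm D)\<^sup>2"
  using assms by (auto simp: information_within_def pos_def_mat_def)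

lemma information_within_product:
  assumes S_pd: "pos_def_mat q S" and X_dim: "X \<in> carrier_mat n p"
    and inv_bounds: "rayleigh_within (mat_inv S) \<alpha> \<beta>" and nonneg: "\<alpha> \<ge> 0" "\<beta> \<ge> 0"
    and gram_bounds: "rayleigh_within (X\<^sup>T * X) a b"
  shows "information_within S X (\<alpha> * a) (\<beta> * b)"
  unfolding information_within_def
proof (intro ballI conjI)
  fix D :: "real mat" assume "D \<in> carrier_mat (dim_col X) (dim_col S)"
  then have D_dim: "D \<in> carrier_mat p q" and XD_dim: "X * D \<in> carrier_mat n q"
    using X_dim S_pd by (auto simp: pos_def_mat_def)
  have norm_XD: "(frob_norm (X * D))\<^sup>2 = frob_inner D (X\<^sup>T * X * D)"
    using frob_inner_mult_left[OF X_dim D_dim XD_dim] X_dim D_dim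
    by (simp add: frob_inner_self assoc_mult_mat[of _ p n])
  have gram_dim: "X\<^sup>T * X \<in> carrier_mat p p" using X_dim by simp
  have "\<alpha> * (a * (frob_norm D)\<^sup>2) \<le> \<alpha> * (frob_norm (X * D))\<^sup>2"
    unfolding norm_XD
    by (intro mult_left_mono rayleigh_within_frob[OF gram_bounds gram_dim D_dim] nonneg)
  also have "\<dots> \<le> mahalanobis S (X * D)" by (rule mahalanobis_within[OF S_pd inv_bounds XD_dim])
  finally show "\<alpha> * a * (frob_norm D)\<^sup>2 \<le> mahalanobis S (X * D)" by (simp add: mult.assoc)
  have "mahalanobis S (X * D) \<le> \<beta> * (frob_norm (X * D))\<^sup>2"
    by (rule mahalanobis_within[OF S_pd inv_bounds XD_dim])
  also have "\<dots> \<le> \<beta> * (b * (frob_norm D)\<^sup>2)"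
    unfolding norm_XD
    by (intro mult_left_mono rayleigh_within_frob[OF gram_bounds gram_dim D_dim] nonneg)
  finally show "mahalanobis S (X * D) \<le> \<beta> * b * (frob_norm D)\<^sup>2" by (simp add: mult.assoc)
qed

section \<open>Lebesgue measure on matrices\<close>

lemma (in product_sigma_finite) distr_PiM_componentwise:
  assumes I_fin: "finite I" and T_meas: "\<And>i. i \<in> I \<Longrightarrow> T i \<in> measurable (M i) (M i)"
    and T_inv: "\<And>i. i \<in> I \<Longrightarrow> distr (M i) (M i) (T i) = M i"
  shows "distr (PiM I M) (PiM I M) (\<lambda>x. \<lambda>i\<in>I. T i (x i)) = PiM I M" (is "distr ?P ?P ?T = ?P")
proof (rule PiM_eqI[OF I_fin])
  have map_meas: "?T \<in> measurable ?P ?P"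
  proof (rule measurable_restrict)
    show "(\<lambda>x. T i (x i)) \<in> measurable ?P (M i)" if "i \<in> I" for i
      by (rule measurable_compose[OF measurable_component_singleton[OF that, of M] T_meas[OF that]])
  qed
  fix A assume A_sets: "\<And>i. i \<in> I \<Longrightarrow> A i \<in> sets (M i)"
  let ?B = "\<lambda>i. T i -` A i \<inter> space (M i)"
  have "emeasure (distr ?P ?P ?T) (Pi\<^sub>E I A) = emeasure ?P (?T -` Pi\<^sub>E I A \<inter> space ?P)"
    using A_sets I_fin by (intro emeasure_distr[OF map_meas] sets_PiM_I_finite) auto
  also have "?T -` Pi\<^sub>E I A \<inter> space ?P = Pi\<^sub>E I ?B"
    by (auto simp: space_PiM PiE_iff)
  also have "emeasure ?P (Pi\<^sub>E I ?B) = (\<Prod>i\<in>I. emeasure (M i) (?B i))"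
    using A_sets T_meas by (intro emeasure_PiM[OF I_fin]) auto
  also have "\<dots> = (\<Prod>i\<in>I. emeasure (distr (M i) (M i) (T i)) (A i))"
    using A_sets T_meas by (intro prod.cong refl emeasure_distr[symmetric])
  also have "\<dots> = (\<Prod>i\<in>I. emeasure (M i) (A i))"
    by (intro prod.cong refl) (simp add: T_inv)
  finally show "emeasure (distr ?P ?P ?T) (Pi\<^sub>E I A) = (\<Prod>i\<in>I. emeasure (M i) (A i))" .
qed simp

abbreviation entry_space :: "nat \<Rightarrow> nat \<Rightarrow> (nat \<times> nat \<Rightarrow> real) measure" where
  "entry_space a b \<equiv> PiM ({..<a} \<times> {..<b}) (\<lambda>_. lborel)"

lemma mat_restrict_entries:
  assumes "A \<in> carrier_mat a b"
  shows "mat a b (restrict (($$) A) ({..<a} \<times> {..<b})) = A"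
  using assms by (intro eq_matI) auto

lemma inj_on_mat_entry_space: "inj_on (mat a b) (space (entry_space a b))"
proof (rule inj_onI)
  fix f g assume f_space: "f \<in> space (entry_space a b)" and g_space: "g \<in> space (entry_space a b)"
    and eq: "mat a b f = mat a b g"
  have "f x = g x" if "x \<in> {..<a} \<times> {..<b}" for x
    using that arg_cong[OF eq, of "\<lambda>A. A $$ x"] by (cases x) auto
  then show "f = g"
    using f_space g_space
    by (intro PiE_ext[of f "{..<a} \<times> {..<b}" "\<lambda>_. UNIV" g]) (auto simp: space_PiM)
qed

lemma mat_space_eq_embed: "mat_space a b = embed_measure (entry_space a b) (mat a b)"
  by (simp add: mat_space_def)

lemma space_mat_space: "space (mat_space a b) = carrier_mat a b"
proof
  show "space (mat_space a b) \<subseteq> carrier_mat a b"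
    by (auto simp: mat_space_eq_embed space_embed_measure)
  show "carrier_mat a b \<subseteq> space (mat_space a b)"
  proof
    fix A :: "real mat" assume "A \<in> carrier_mat a b"
    then show "A \<in> space (mat_space a b)"
      unfolding mat_space_eq_embed space_embed_measure
      by (intro image_eqI[where x = "restrict (($$) A) ({..<a} \<times> {..<b})"])
        (auto simp: space_PiM mat_restrict_entries)
  qed
qed

lemma measurable_mat_entry_space: "mat a b \<in> measurable (entry_space a b) (mat_space a b)"
  unfolding mat_space_eq_embed by (rule measurable_embed_measure2'[OF inj_on_mat_entry_space])

lemma mat_space_eq_distr: "mat_space a b = distr (entry_space a b) (mat_space a b) (mat a b)"
  unfolding mat_space_eq_embed by (rule embed_measure_eq_distr'[OF inj_on_mat_entry_space])

lemma measurable_mat_spaceI: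
  assumes carrier: "\<And>\<omega>. \<omega> \<in> space N \<Longrightarrow> F \<omega> \<in> carrier_mat a b"
    and entry: "\<And>i j \<omega>. i < a \<Longrightarrow> j < b \<Longrightarrow> \<omega> \<in> space N \<Longrightarrow> F \<omega> $$ (i, j) = f i j \<omega>"
    and f_meas: "\<And>i j. i < a \<Longrightarrow> j < b \<Longrightarrow> f i j \<in> borel_measurable N"
  shows "F \<in> measurable N (mat_space a b)"
proof -
  have "(\<lambda>\<omega>. \<lambda>x\<in>{..<a} \<times> {..<b}. f (fst x) (snd x) \<omega>) \<in> measurable N (entry_space a b)"
    by (rule measurable_restrict) (use f_meas in auto)
  then have "(\<lambda>\<omega>. mat a b (\<lambda>x\<in>{..<a} \<times> {..<b}. f (fst x) (snd x) \<omega>)) \<in> measurable N (mat_space a b)"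
    by (rule measurable_compose[OF _ measurable_mat_entry_space])
  moreover have "mat a b (\<lambda>x\<in>{..<a} \<times> {..<b}. f (fst x) (snd x) \<omega>) = F \<omega>" if "\<omega> \<in> space N" for \<omega>
    using carrier[OF that] entry that by (intro eq_matI) auto
  ultimately show ?thesis
    by (rule measurable_cong[THEN iffD1, rotated])
qed

lemma measurable_mat_spaceD:
  assumes F_meas: "F \<in> measurable N (mat_space a b)"
  shows "\<omega> \<in> space N \<Longrightarrow> F \<omega> \<in> carrier_mat a b"
    and "i < a \<Longrightarrow> j < b \<Longrightarrow> (\<lambda>\<omega>. F \<omega> $$ (i, j)) \<in> borel_measurable N"
proof -
  show "F \<omega> \<in> carrier_mat a b" if "\<omega> \<in> space N"
    using measurable_space[OF F_meas that] by (simp add: space_mat_space)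
  assume ij: "i < a" "j < b"
  have "(\<lambda>A. A $$ (i, j)) \<in> borel_measurable (mat_space a b)"
    unfolding mat_space_eq_embed
  proof (rule measurable_embed_measure1)
    show "(\<lambda>x. mat a b x $$ (i, j)) \<in> borel_measurable (entry_space a b)"
      using ij measurable_component_singleton[of "(i, j)" "{..<a} \<times> {..<b}" "\<lambda>_. lborel"] by simp
  qed
  then show "(\<lambda>\<omega>. F \<omega> $$ (i, j)) \<in> borel_measurable N"
    by (rule measurable_compose[OF F_meas])
qed

lemma measurable_mat_const: "A \<in> carrier_mat a b \<Longrightarrow> (\<lambda>_. A) \<in> measurable N (mat_space a b)"
  by (rule measurable_const) (simp add: space_mat_space)

lemma measurable_mat_diff:
  assumes F_meas: "F \<in> measurable N (mat_space a b)" and G_meas: "G \<in> measurable N (mat_space a b)"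
  shows "(\<lambda>\<omega>. F \<omega> - G \<omega>) \<in> measurable N (mat_space a b)"
proof (rule measurable_mat_spaceI)
  fix \<omega> assume \<omega>: "\<omega> \<in> space N"
  show "F \<omega> - G \<omega> \<in> carrier_mat a b"
    using measurable_mat_spaceD(1)[OF G_meas \<omega>] by (rule minus_carrier_mat)
  show "(F \<omega> - G \<omega>) $$ (i, j) = F \<omega> $$ (i, j) - G \<omega> $$ (i, j)" if "i < a" "j < b" for i j
    using measurable_mat_spaceD(1)[OF G_meas \<omega>] that by simp
qed (intro borel_measurable_diff measurable_mat_spaceD(2)[OF F_meas]
    measurable_mat_spaceD(2)[OF G_meas])

lemma measurable_mat_mult:
  assumes F_meas: "F \<in> measurable N (mat_space a b)" and G_meas: "G \<in> measurable N (mat_space b c)"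
  shows "(\<lambda>\<omega>. F \<omega> * G \<omega>) \<in> measurable N (mat_space a c)"
proof (rule measurable_mat_spaceI)
  fix \<omega> assume \<omega>: "\<omega> \<in> space N"
  note carrier = measurable_mat_spaceD(1)[OF F_meas \<omega>] measurable_mat_spaceD(1)[OF G_meas \<omega>]
  show "F \<omega> * G \<omega> \<in> carrier_mat a c"
    using carrier by (rule mult_carrier_mat)
  show "(F \<omega> * G \<omega>) $$ (i, j) = (\<Sum>k<b. F \<omega> $$ (i, k) * G \<omega> $$ (k, j))" if "i < a" "j < c" for i j
    using carrier that by (auto simp: scalar_prod_def lessThan_atLeast0)
qed (auto intro!: borel_measurable_sum borel_measurable_times measurable_mat_spaceD(2)[OF F_meas]
    measurable_mat_spaceD(2)[OF G_meas])

lemma measurable_frob_inner: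
  assumes F_meas: "F \<in> measurable N (mat_space a b)" and G_meas: "G \<in> measurable N (mat_space a b)"
  shows "(\<lambda>\<omega>. frob_inner (F \<omega>) (G \<omega>)) \<in> borel_measurable N"
proof -
  have "frob_inner (F \<omega>) (G \<omega>) = (\<Sum>x\<in>{..<a} \<times> {..<b}. F \<omega> $$ x * G \<omega> $$ x)" if "\<omega> \<in> space N" for \<omega>
    using measurable_mat_spaceD(1)[OF F_meas that] by (simp add: frob_inner_def)
  moreover have "(\<lambda>\<omega>. \<Sum>x\<in>{..<a} \<times> {..<b}. F \<omega> $$ x * G \<omega> $$ x) \<in> borel_measurable N"
    by (auto intro!: borel_measurable_sum borel_measurable_times measurable_mat_spaceD(2)[OF F_meas]
        measurable_mat_spaceD(2)[OF G_meas])
  ultimately show ?thesis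
    by (subst measurable_cong)
qed

lemma measurable_frob_norm:
  assumes "F \<in> measurable N (mat_space a b)"
  shows "(\<lambda>\<omega>. frob_norm (F \<omega>)) \<in> borel_measurable N"
proof -
  have "frob_norm A = sqrt (frob_inner A A)" for A by (simp add: frob_inner_self)
  then show ?thesis using measurable_frob_inner[OF assms assms] by simp
qed

lemma mat_space_translation:
  assumes H_dim: "H \<in> carrier_mat a b"
  shows "distr (mat_space a b) (mat_space a b) (\<lambda>Y. Y - H) = mat_space a b"
proof -
  interpret product_sigma_finite "\<lambda>_ :: nat \<times> nat. lborel :: real measure"
    by (simp add: product_sigma_finite_def sigma_finite_lborel)
  let ?P = "entry_space a b" and ?M = "mat_space a b"
  let ?T = "\<lambda>x. \<lambda>i\<in>{..<a} \<times> {..<b}. x i - H $$ i"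
  have "distr lborel lborel (\<lambda>y. y - h) = lborel" for h :: real
    using lborel_distr_plus[of "- h"] by (simp cong: distr_cong)
  then have invariant: "distr ?P ?P ?T = ?P"
    by (intro distr_PiM_componentwise) auto
  have T_meas: "?T \<in> measurable ?P ?P"
    by (rule measurable_restrict)
      (simp add: measurable_component_singleton[of _ "{..<a} \<times> {..<b}" "\<lambda>_. lborel", simplified])
  note mat_meas = measurable_mat_entry_space
  have diff_meas: "(\<lambda>Y. Y - H) \<in> measurable ?M ?M"
    by (intro measurable_mat_diff measurable_mat_const H_dim) simp
  have "distr ?M ?M (\<lambda>Y. Y - H) = distr ?P ?M (\<lambda>x. mat a b x - H)"
    by (subst mat_space_eq_distr) (simp add: distr_distr[OF diff_meas mat_meas] o_def)
  also have "\<dots> = distr ?P ?M (\<lambda>x. mat a b (?T x))"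
    using H_dim by (intro distr_cong refl eq_matI) auto
  also have "\<dots> = distr (distr ?P ?P ?T) ?M (mat a b)"
    by (simp add: distr_distr[OF mat_meas T_meas] o_def)
  also have "\<dots> = ?M" by (simp add: invariant mat_space_eq_distr[symmetric])
  finally show ?thesis .
qed

section \<open>Sub-Gaussian random vectors\<close>

lemma nn_integral_normal_density:
  assumes "\<sigma> > 0"
  shows "(\<integral>\<^sup>+ z. ennreal (normal_density \<mu> \<sigma> z) \<partial>lborel) = 1"
  using assms by (simp add: nn_integral_eq_integral normal_density_nonneg)

abbreviation std_normal :: "real measure" where
  "std_normal \<equiv> density lborel (\<lambda>z. ennreal (std_normal_density z))"

lemma nn_integral_std_normal_exp:
  assumes g_meas: "g \<in> borel_measurable borel" and "K \<ge> 0" "\<sigma> > 0"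
    and tilt: "\<And>z. std_normal_density z * exp (g z) = K * normal_density \<mu> \<sigma> z"
  shows "(\<integral>\<^sup>+ z. ennreal (exp (g z)) \<partial>std_normal) = ennreal K"
proof -
  have "(\<integral>\<^sup>+ z. ennreal (exp (g z)) \<partial>std_normal)
      = (\<integral>\<^sup>+ z. ennreal K * ennreal (normal_density \<mu> \<sigma> z) \<partial>lborel)"
    using g_meas \<open>K \<ge> 0\<close> by (simp add: nn_integral_density ennreal_mult[symmetric] tilt)
  also have "\<dots> = ennreal K"
    using \<open>\<sigma> > 0\<close> by (simp add: nn_integral_cmult nn_integral_normal_density)
  finally show ?thesis .
qed

lemma std_normal_mgf: "(\<integral>\<^sup>+ z. ennreal (exp (c * z)) \<partial>std_normal) = ennreal (exp (c\<^sup>2 / 2))"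
  by (rule nn_integral_std_normal_exp[where \<mu> = c and \<sigma> = 1])
    (simp_all add: normal_density_def exp_add[symmetric] field_simps power2_eq_square)

lemma std_normal_exp_square: "(\<integral>\<^sup>+ z. ennreal (exp (z\<^sup>2 / 4)) \<partial>std_normal) = ennreal (sqrt 2)"
  by (rule nn_integral_std_normal_exp[where \<mu> = 0 and \<sigma> = "sqrt 2"])
    (simp_all add: normal_density_def exp_add[symmetric] field_simps real_sqrt_mult)

definition std_gaussian :: "'i set \<Rightarrow> ('i \<Rightarrow> real) measure" where
  "std_gaussian I = PiM I (\<lambda>_. std_normal)"

lemma product_prob_space_std_normal: "product_prob_space (\<lambda>_. std_normal)"
proof -
  interpret prob_space std_normal by (rule prob_space_normal_density) simp
  show ?thesis by unfold_locales
qed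

lemma prob_space_std_gaussian: "prob_space (std_gaussian I)"
  unfolding std_gaussian_def by (intro prob_space_PiM prob_space_normal_density) simp

lemma measurable_std_gaussian_component:
  assumes "i \<in> I"
  shows "(\<lambda>z. z i) \<in> borel_measurable (std_gaussian I)"
  using measurable_component_singleton[OF assms, of "\<lambda>_. std_normal"]
  unfolding std_gaussian_def by simp

lemma nn_integral_std_gaussian_exp_sum:
  assumes I_fin: "finite I" and f_meas: "\<And>i. i \<in> I \<Longrightarrow> f i \<in> borel_measurable borel"
  shows "(\<integral>\<^sup>+ z. ennreal (exp (\<Sum>i\<in>I. f i (z i))) \<partial>std_gaussian I)
    = (\<Prod>i\<in>I. \<integral>\<^sup>+ x. ennreal (exp (f i x)) \<partial>std_normal)"
proof -
  interpret product_prob_space "\<lambda>_ :: 'a. std_normal" by (rule product_prob_space_std_normal)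
  have "(\<integral>\<^sup>+ z. (\<Prod>i\<in>I. ennreal (exp (f i (z i)))) \<partial>std_gaussian I)
      = (\<Prod>i\<in>I. \<integral>\<^sup>+ x. ennreal (exp (f i x)) \<partial>std_normal)"
    unfolding std_gaussian_def using f_meas by (intro product_nn_integral_prod[OF I_fin]) auto
  then show ?thesis by (simp add: exp_sum[OF I_fin] prod_ennreal)
qed

lemma std_gaussian_mgf:
  assumes "finite I"
  shows "(\<integral>\<^sup>+ z. ennreal (exp (\<Sum>i\<in>I. c i * z i)) \<partial>std_gaussian I)
    = ennreal (exp (\<Sum>i\<in>I. (c i)\<^sup>2 / 2))"
  unfolding nn_integral_std_gaussian_exp_sum[OF assms, of "\<lambda>i x. c i * x", simplified]
    std_normal_mgf
  by (simp add: prod_ennreal exp_sum[OF assms])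

lemma std_gaussian_exp_square:
  assumes "finite I"
  shows "(\<integral>\<^sup>+ z. ennreal (exp (\<Sum>i\<in>I. (z i)\<^sup>2 / 4)) \<partial>std_gaussian I) = ennreal (sqrt 2 ^ card I)"
  unfolding nn_integral_std_gaussian_exp_sum[OF assms, of "\<lambda>_ x. x\<^sup>2 / 4", simplified]
    std_normal_exp_square
  by (simp add: ennreal_power)

definition subgaussian :: "'w measure \<Rightarrow> 'i set \<Rightarrow> real \<Rightarrow> ('i \<Rightarrow> 'w \<Rightarrow> real) \<Rightarrow> bool" where
  "subgaussian M I L G \<longleftrightarrow> (\<forall>i\<in>I. G i \<in> borel_measurable M) \<and>
     (\<forall>c. (\<integral>\<^sup>+ \<omega>. ennreal (exp (\<Sum>i\<in>I. c i * G i \<omega>)) \<partial>M)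
       \<le> ennreal (exp (L / 2 * (\<Sum>i\<in>I. (c i)\<^sup>2))))"

lemma subgaussianD:
  assumes "subgaussian M I L G"
  shows "i \<in> I \<Longrightarrow> G i \<in> borel_measurable M"
    and "(\<integral>\<^sup>+ \<omega>. ennreal (exp (\<Sum>i\<in>I. c i * G i \<omega>)) \<partial>M)
      \<le> ennreal (exp (L / 2 * (\<Sum>i\<in>I. (c i)\<^sup>2)))"
  using assms by (simp_all add: subgaussian_def)

lemma subgaussian_exp_square:
  assumes "prob_space M" and I_fin: "finite I" and L_pos: "L > 0"
    and G_subgaussian: "subgaussian M I L G"
  shows "(\<integral>\<^sup>+ \<omega>. ennreal (exp ((\<Sum>i\<in>I. (G i \<omega>)\<^sup>2) / (4 * L))) \<partial>M) \<le> ennreal (sqrt 2 ^ card I)"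
proof -
  let ?\<gamma> = "std_gaussian I"
  interpret M: prob_space M by fact
  interpret \<gamma>: prob_space ?\<gamma> by (rule prob_space_std_gaussian)
  interpret pair_sigma_finite M ?\<gamma> ..
  define s where "s = 1 / sqrt (2 * L)"
  have s_square: "s\<^sup>2 = 1 / (2 * L)" using L_pos by (simp add: s_def power_divide)
  have "(\<lambda>(\<omega>, z). \<Sum>i\<in>I. s * G i \<omega> * z i) \<in> borel_measurable (M \<Otimes>\<^sub>M ?\<gamma>)"
    unfolding case_prod_beta
    by (intro borel_measurable_sum borel_measurable_times borel_measurable_const
        measurable_compose[OF measurable_snd measurable_std_gaussian_component]
        measurable_compose[OF measurable_fst subgaussianD(1)[OF G_subgaussian]])
  then have meas: "(\<lambda>(\<omega>, z). ennreal (exp (\<Sum>i\<in>I. s * G i \<omega> * z i))) \<in> borel_measurable (M \<Otimes>\<^sub>M ?\<gamma>)"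
    unfolding case_prod_beta by measurable
  have "(\<Sum>i\<in>I. (G i \<omega>)\<^sup>2) / (4 * L) = (\<Sum>i\<in>I. (s * G i \<omega>)\<^sup>2 / 2)" for \<omega>
    by (simp add: power_mult_distrib s_square sum_divide_distrib)
  then have "(\<integral>\<^sup>+ \<omega>. ennreal (exp ((\<Sum>i\<in>I. (G i \<omega>)\<^sup>2) / (4 * L))) \<partial>M)
      = (\<integral>\<^sup>+ \<omega>. \<integral>\<^sup>+ z. ennreal (exp (\<Sum>i\<in>I. s * G i \<omega> * z i)) \<partial>?\<gamma> \<partial>M)"
    by (simp only: std_gaussian_mgf[OF I_fin])
  also have "\<dots> = (\<integral>\<^sup>+ z. \<integral>\<^sup>+ \<omega>. ennreal (exp (\<Sum>i\<in>I. s * G i \<omega> * z i)) \<partial>M \<partial>?\<gamma>)"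
    by (rule Fubini'[OF meas, symmetric])
  also have "\<dots> = (\<integral>\<^sup>+ z. \<integral>\<^sup>+ \<omega>. ennreal (exp (\<Sum>i\<in>I. (s * z i) * G i \<omega>)) \<partial>M \<partial>?\<gamma>)"
    by (simp only: mult_ac)
  also have "\<dots> \<le> (\<integral>\<^sup>+ z. ennreal (exp (L / 2 * (\<Sum>i\<in>I. (s * z i)\<^sup>2))) \<partial>?\<gamma>)"
    by (intro nn_integral_mono subgaussianD(2)[OF G_subgaussian])
  also have "\<dots> = (\<integral>\<^sup>+ z. ennreal (exp (\<Sum>i\<in>I. (z i)\<^sup>2 / 4)) \<partial>?\<gamma>)"
    using L_pos by (simp add: power_mult_distrib s_square sum_distrib_left)
  also have "\<dots> = ennreal (sqrt 2 ^ card I)"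
    by (rule std_gaussian_exp_square[OF I_fin])
  finally show ?thesis .
qed

lemma subgaussian_norm_tail:
  assumes "prob_space M" and I_fin: "finite I" and L_pos: "L > 0"
    and G_subgaussian: "subgaussian M I L G"
  shows "measure M {\<omega> \<in> space M. r \<le> (\<Sum>i\<in>I. (G i \<omega>)\<^sup>2)} \<le> sqrt 2 ^ card I * exp (- r / (4 * L))"
proof -
  interpret prob_space M by fact
  let ?N = "\<lambda>\<omega>. \<Sum>i\<in>I. (G i \<omega>)\<^sup>2" and ?t = "1 / (4 * L)"
  have [measurable]: "?N \<in> borel_measurable M"
    using subgaussianD(1)[OF G_subgaussian] by measurable
  have "emeasure M {\<omega> \<in> space M. r \<le> ?N \<omega>}
      \<le> ennreal (exp (- ?t * r)) * (\<integral>\<^sup>+ \<omega>. ennreal (exp (?t * ?N \<omega>)) * indicator (space M) \<omega> \<partial>M)"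
    using L_pos by (intro Chernoff_ineq_nn_integral_ge) auto
  also have "(\<integral>\<^sup>+ \<omega>. ennreal (exp (?t * ?N \<omega>)) * indicator (space M) \<omega> \<partial>M)
      = (\<integral>\<^sup>+ \<omega>. ennreal (exp (?N \<omega> / (4 * L))) \<partial>M)"
    by (intro nn_integral_cong) simp
  also have "ennreal (exp (- ?t * r)) * \<dots> \<le> ennreal (exp (- ?t * r)) * ennreal (sqrt 2 ^ card I)"
    by (intro mult_left_mono subgaussian_exp_square[OF \<open>prob_space M\<close> I_fin L_pos G_subgaussian])
      simp
  finally have "ennreal (measure M {\<omega> \<in> space M. r \<le> ?N \<omega>})
      \<le> ennreal (exp (- ?t * r) * sqrt 2 ^ card I)"
    by (simp add: emeasure_eq_measure ennreal_mult)
  then show ?thesis by (simp add: mult.commute)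
qed

section \<open>The matrix-normal density\<close>

definition mn_normalizer :: "nat \<Rightarrow> nat \<Rightarrow> real mat \<Rightarrow> real" where
  "mn_normalizer n q S = (2 * pi) powr (- (real n * real q) / 2) * det S powr (- real n / 2)"

lemma mn_density_identity_rows:
  assumes S_pd: "pos_def_mat q S" and M_dim: "M \<in> carrier_mat n q" and Y_dim: "Y \<in> carrier_mat n q"
  shows "mn_density M (1\<^sub>m n) S Y = mn_normalizer n q S * exp (- mahalanobis S (Y - M) / 2)"
proof -
  note S_inv = pos_def_mat_inverse(1)[OF S_pd]
  have YM_dim: "Y - M \<in> carrier_mat n q" using M_dim by (rule minus_carrier_mat)
  have "mat_inv (1\<^sub>m n) = 1\<^sub>m n"
    using mat_inv_of_det_nonzero[of "1\<^sub>m n" n] by simp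
  then have "mat_trace (mat_inv (1\<^sub>m n) * (Y - M) * mat_inv S * (Y - M)\<^sup>T)
      = mahalanobis S (Y - M)"
    using mat_trace_mult_transpose[OF mult_carrier_mat[OF YM_dim S_inv] YM_dim]
    by (simp add: left_mult_one_mat[OF YM_dim] mahalanobis_def)
  then show ?thesis
    using M_dim by (simp add: mn_density_def mn_normalizer_def Let_def)
qed

lemma mn_density_pos:
  assumes "pos_def_mat q S" "M \<in> carrier_mat n q" "Y \<in> carrier_mat n q"
  shows "mn_density M (1\<^sub>m n) S Y > 0"
  using pos_def_mat_det_nonzero[OF assms(1)]
  by (simp add: mn_density_identity_rows[OF assms] mn_normalizer_def)

lemma mn_density_tilt:
  assumes S_pd: "pos_def_mat q S"
    and M_dim: "M \<in> carrier_mat n q" and H_dim: "H \<in> carrier_mat n q"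
    and Y_dim: "Y \<in> carrier_mat n q"
  shows "mn_density (M + H) (1\<^sub>m n) S Y
    = mn_density M (1\<^sub>m n) S Y * exp (frob_inner H ((Y - M) * mat_inv S) - mahalanobis S H / 2)"
proof -
  have YM_dim: "Y - M \<in> carrier_mat n q" using M_dim by (rule minus_carrier_mat)
  have "Y - (M + H) = (Y - M) - H"
    using M_dim H_dim Y_dim by (intro eq_matI) auto
  then have "- mahalanobis S (Y - (M + H)) / 2 = - mahalanobis S (Y - M) / 2
      + (frob_inner H ((Y - M) * mat_inv S) - mahalanobis S H / 2)"
    by (simp add: mahalanobis_diff[OF S_pd YM_dim H_dim] field_simps)
  moreover have "M + H \<in> carrier_mat n q" using M_dim H_dim by simp
  ultimately show ?thesis
    using M_dim Y_dim by (simp only: mn_density_identity_rows[OF S_pd] exp_add mult.assoc)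
qed

lemma measurable_mn_density:
  assumes S_pd: "pos_def_mat q S"
    and F_meas: "F \<in> measurable N (mat_space n q)" and G_meas: "G \<in> measurable N (mat_space n q)"
  shows "(\<lambda>\<omega>. mn_density (F \<omega>) (1\<^sub>m n) S (G \<omega>)) \<in> borel_measurable N"
proof -
  have [measurable]: "(\<lambda>\<omega>. mahalanobis S (G \<omega> - F \<omega>)) \<in> borel_measurable N"
    unfolding mahalanobis_def
    by (intro measurable_frob_inner[of _ _ n q] measurable_mat_mult[of _ _ n q _ q]
        measurable_mat_diff[OF G_meas F_meas] measurable_mat_const pos_def_mat_inverse(1)[OF S_pd])
  have "(\<lambda>\<omega>. mn_normalizer n q S * exp (- mahalanobis S (G \<omega> - F \<omega>) / 2)) \<in> borel_measurable N"
    by measurable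
  then show ?thesis
    by (subst measurable_cong[OF mn_density_identity_rows[OF S_pd]])
      (auto intro: measurable_mat_spaceD(1)[OF F_meas] measurable_mat_spaceD(1)[OF G_meas])
qed

lemma nn_integral_mn_density_mean:
  assumes S_pd: "pos_def_mat q S" and H_dim: "H \<in> carrier_mat n q"
  shows "(\<integral>\<^sup>+ Y. ennreal (mn_density H (1\<^sub>m n) S Y) \<partial>mat_space n q)
    = (\<integral>\<^sup>+ Y. ennreal (mn_density (0\<^sub>m n q) (1\<^sub>m n) S Y) \<partial>mat_space n q)"
proof -
  let ?M = "mat_space n q" and ?f = "mn_density (0\<^sub>m n q) (1\<^sub>m n) S"
  have density_meas: "(\<lambda>Y. ennreal (?f Y)) \<in> borel_measurable ?M"
    using measurable_mn_density[OF S_pd measurable_mat_const measurable_ident] by simp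
  have shift_meas: "(\<lambda>Y. Y - H) \<in> measurable ?M ?M"
    by (intro measurable_mat_diff measurable_mat_const H_dim) simp
  have "(\<integral>\<^sup>+ Y. ennreal (?f Y) \<partial>?M) = (\<integral>\<^sup>+ Y. ennreal (?f Y) \<partial>distr ?M ?M (\<lambda>Y. Y - H))"
    by (simp add: mat_space_translation[OF H_dim])
  also have "\<dots> = (\<integral>\<^sup>+ Y. ennreal (?f (Y - H)) \<partial>?M)"
    using density_meas by (intro nn_integral_distr[OF shift_meas]) simp
  also have "\<dots> = (\<integral>\<^sup>+ Y. ennreal (mn_density H (1\<^sub>m n) S Y) \<partial>?M)"
  proof (rule nn_integral_cong)
    fix Y assume "Y \<in> space ?M"
    then have Y_dim: "Y \<in> carrier_mat n q" by (simp add: space_mat_space)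
    have "Y - H - 0\<^sub>m n q = Y - H" using Y_dim H_dim by (intro eq_matI) auto
    then show "ennreal (?f (Y - H)) = ennreal (mn_density H (1\<^sub>m n) S Y)"
      using Y_dim H_dim by (simp add: mn_density_identity_rows[OF S_pd] minus_carrier_mat)
  qed
  finally show ?thesis ..
qed

lemma matrix_normal_mgf:
  assumes S_pd: "pos_def_mat q S" and "prob_space M"
    and noise: "distributed M (mat_space n q) E (\<lambda>Y. ennreal (mn_density (0\<^sub>m n q) (1\<^sub>m n) S Y))"
    and H_dim: "H \<in> carrier_mat n q"
  shows "(\<integral>\<^sup>+ \<omega>. ennreal (exp (frob_inner H (E \<omega> * mat_inv S))) \<partial>M)
    = ennreal (exp (mahalanobis S H / 2))"
proof -
  interpret prob_space M by fact
  let ?M = "mat_space n q" and ?f = "\<lambda>H. mn_density H (1\<^sub>m n) S" and ?O = "0\<^sub>m n q"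
  have density_meas: "(\<lambda>Y. ennreal (?f H Y)) \<in> borel_measurable ?M"
    using measurable_mn_density[OF S_pd measurable_mat_const[OF H_dim] measurable_ident] by simp
  have "(\<lambda>Y. frob_inner H (Y * mat_inv S)) \<in> borel_measurable ?M"
    by (rule measurable_frob_inner[OF measurable_mat_const[OF H_dim]
          measurable_mat_mult[OF _ measurable_mat_const[OF pos_def_mat_inverse(1)[OF S_pd]]]]) simp
  then have exp_meas: "(\<lambda>Y. ennreal (exp (frob_inner H (Y * mat_inv S)))) \<in> borel_measurable ?M"
    by simp
  have tilt: "?f ?O Y * exp (frob_inner H (Y * mat_inv S)) = exp (mahalanobis S H / 2) * ?f H Y"
    if Y_dim: "Y \<in> carrier_mat n q" for Y
  proof -
    have "Y - ?O = Y" "?O + H = H" using Y_dim H_dim by (auto intro!: eq_matI)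
    then show ?thesis
      using mn_density_tilt[OF S_pd _ H_dim Y_dim, of ?O] by (simp add: exp_diff)
  qed
  have "(\<integral>\<^sup>+ \<omega>. ennreal (exp (frob_inner H (E \<omega> * mat_inv S))) \<partial>M)
      = (\<integral>\<^sup>+ Y. ennreal (?f ?O Y) * ennreal (exp (frob_inner H (Y * mat_inv S))) \<partial>?M)"
    by (rule distributed_nn_integral[OF noise exp_meas, symmetric])
  also have "\<dots> = (\<integral>\<^sup>+ Y. ennreal (exp (mahalanobis S H / 2)) * ennreal (?f H Y) \<partial>?M)"
    using tilt
    by (intro nn_integral_cong)
      (simp add: space_mat_space ennreal_mult'[symmetric] ennreal_mult''[symmetric])
  also have "\<dots> = ennreal (exp (mahalanobis S H / 2)) * (\<integral>\<^sup>+ Y. ennreal (?f ?O Y) * 1 \<partial>?M)"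
    by (simp add: nn_integral_cmult[OF density_meas] nn_integral_mn_density_mean[OF S_pd H_dim])
  also have "(\<integral>\<^sup>+ Y. ennreal (?f ?O Y) * 1 \<partial>?M) = (\<integral>\<^sup>+ \<omega>. 1 \<partial>M)"
    by (rule distributed_nn_integral[OF noise]) simp
  finally show ?thesis by (simp add: emeasure_space_1)
qed

section \<open>The score and the likelihood ratio\<close>

definition score :: "real mat \<Rightarrow> real mat \<Rightarrow> real mat \<Rightarrow> real mat" where
  "score S X N = X\<^sup>T * (N * mat_inv S)"

lemma score_carrier:
  assumes "pos_def_mat q S" "X \<in> carrier_mat n p" "N \<in> carrier_mat n q"
  shows "score S X N \<in> carrier_mat p q"
  using assms pos_def_mat_inverse(1)[OF assms(1)] by (simp add: score_def)

lemma frob_inner_score: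
  assumes "pos_def_mat q S" "X \<in> carrier_mat n p" "N \<in> carrier_mat n q" "D \<in> carrier_mat p q"
  shows "frob_inner D (score S X N) = frob_inner (X * D) (N * mat_inv S)"
  using assms pos_def_mat_inverse(1)[OF assms(1)] unfolding score_def
  by (intro frob_inner_mult_left[symmetric]) auto

lemma measurable_score:
  assumes S_pd: "pos_def_mat q S" and X_dim: "X \<in> carrier_mat n p"
    and E_meas: "E \<in> measurable M (mat_space n q)"
  shows "(\<lambda>\<omega>. score S X (E \<omega>)) \<in> measurable M (mat_space p q)"
  unfolding score_def using X_dim
  by (intro measurable_mat_mult[of _ _ p n _ q] measurable_mat_mult[of _ _ n q _ q]
      measurable_mat_const E_meas pos_def_mat_inverse(1)[OF S_pd]) simp

lemma subgaussian_score:
  assumes S_pd: "pos_def_mat q S" and "prob_space M"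
    and noise: "distributed M (mat_space n q) E (\<lambda>Y. ennreal (mn_density (0\<^sub>m n q) (1\<^sub>m n) S Y))"
    and X_dim: "X \<in> carrier_mat n p" and info: "information_within S X a b"
  shows "subgaussian M ({..<p} \<times> {..<q}) b (\<lambda>x \<omega>. score S X (E \<omega>) $$ x)"
  unfolding subgaussian_def
proof (intro conjI ballI allI)
  let ?I = "{..<p} \<times> {..<q}"
  have E_meas: "E \<in> measurable M (mat_space n q)" using noise by (rule distributed_measurable)
  show "(\<lambda>\<omega>. score S X (E \<omega>) $$ x) \<in> borel_measurable M" if "x \<in> ?I" for x
    using that measurable_mat_spaceD(2)[OF measurable_score[OF S_pd X_dim E_meas]] by auto
  fix c :: "nat \<times> nat \<Rightarrow> real"
  define D where "D = mat p q c"
  have D_dim: "D \<in> carrier_mat p q" by (simp add: D_def)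
  have XD_dim: "X * D \<in> carrier_mat n q" using X_dim D_dim by simp
  have linear: "(\<Sum>x\<in>?I. c x * score S X (E \<omega>) $$ x) = frob_inner (X * D) (E \<omega> * mat_inv S)"
    if "\<omega> \<in> space M" for \<omega>
    unfolding frob_inner_score[OF S_pd X_dim measurable_mat_spaceD(1)[OF E_meas that] D_dim,
      symmetric]
    by (auto simp: frob_inner_def D_def intro!: sum.cong)
  have norm_D: "(frob_norm D)\<^sup>2 = (\<Sum>x\<in>?I. (c x)\<^sup>2)"
    unfolding frob_norm_sq[OF D_dim] by (auto simp: D_def intro!: sum.cong)
  have "(\<integral>\<^sup>+ \<omega>. ennreal (exp (\<Sum>x\<in>?I. c x * score S X (E \<omega>) $$ x)) \<partial>M)
      = (\<integral>\<^sup>+ \<omega>. ennreal (exp (frob_inner (X * D) (E \<omega> * mat_inv S))) \<partial>M)"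
    by (intro nn_integral_cong) (simp add: linear)
  also have "\<dots> = ennreal (exp (mahalanobis S (X * D) / 2))"
    by (rule matrix_normal_mgf[OF S_pd \<open>prob_space M\<close> noise XD_dim])
  also have "\<dots> \<le> ennreal (exp (b / 2 * (\<Sum>x\<in>?I. (c x)\<^sup>2)))"
    using information_withinD(2)[OF S_pd X_dim info D_dim] unfolding norm_D[symmetric]
    by (intro ennreal_leI) simp
  finally show "(\<integral>\<^sup>+ \<omega>. ennreal (exp (\<Sum>x\<in>?I. c x * score S X (E \<omega>) $$ x)) \<partial>M)
    \<le> ennreal (exp (b / 2 * (\<Sum>x\<in>?I. (c x)\<^sup>2)))" .
qed

lemma score_norm_tail:
  assumes S_pd: "pos_def_mat q S" and M_prob: "prob_space M"
    and noise: "distributed M (mat_space n q) E (\<lambda>Y. ennreal (mn_density (0\<^sub>m n q) (1\<^sub>m n) S Y))"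
    and X_dim: "X \<in> carrier_mat n p" and info: "information_within S X a b" and b_pos: "b > 0"
    and t_nonneg: "t \<ge> 0"
  shows "measure M {\<omega> \<in> space M. t \<le> frob_norm (score S X (E \<omega>))}
      \<le> sqrt 2 ^ (p * q) * exp (- t\<^sup>2 / (4 * b))"
proof -
  have E_meas: "E \<in> measurable M (mat_space n q)" using noise by (rule distributed_measurable)
  have "(frob_norm (score S X (E \<omega>)))\<^sup>2 = (\<Sum>x\<in>{..<p} \<times> {..<q}. (score S X (E \<omega>) $$ x)\<^sup>2)"
    if "\<omega> \<in> space M" for \<omega>
    using score_carrier[OF S_pd X_dim measurable_mat_spaceD(1)[OF E_meas that]]
    by (rule frob_norm_sq)
  moreover have "t \<le> frob_norm A \<longleftrightarrow> t\<^sup>2 \<le> (frob_norm A)\<^sup>2" for A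
    using abs_le_square_iff[of t "frob_norm A"] t_nonneg by simp
  ultimately have "{\<omega> \<in> space M. t \<le> frob_norm (score S X (E \<omega>))}
      = {\<omega> \<in> space M. t\<^sup>2 \<le> (\<Sum>x\<in>{..<p} \<times> {..<q}. (score S X (E \<omega>) $$ x)\<^sup>2)}"
    by auto
  then show ?thesis
    using subgaussian_norm_tail[OF M_prob _ b_pos
        subgaussian_score[OF S_pd M_prob noise X_dim info]]
    by (simp add: card_cartesian_product)
qed

lemma likelihood_ratio:
  assumes S_pd: "pos_def_mat q S" and X_dim: "X \<in> carrier_mat n p" and N_dim: "N \<in> carrier_mat n q"
    and B0_dim: "B0 \<in> carrier_mat p q" and B_dim: "B \<in> carrier_mat p q"
  shows "mn_density (X * B) (1\<^sub>m n) S (X * B0 + N) = mn_density (X * B0) (1\<^sub>m n) S (X * B0 + N)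
    * exp (frob_inner (B - B0) (score S X N) - mahalanobis S (X * (B - B0)) / 2)"
proof -
  have D_dim: "B - B0 \<in> carrier_mat p q" using B0_dim by (rule minus_carrier_mat)
  have "X * B = X * B0 + X * (B - B0)"
    using X_dim B_dim B0_dim by (simp add: mult_minus_distrib_mat) (auto intro!: eq_matI)
  moreover have "X * B0 + N - X * B0 = N"
    using X_dim B0_dim N_dim by (intro eq_matI) auto
  ultimately show ?thesis
    using mn_density_tilt[OF S_pd, of "X * B0" n "X * (B - B0)" "X * B0 + N"]
      X_dim B0_dim N_dim D_dim
    by (simp add: frob_inner_score[OF S_pd X_dim N_dim D_dim])
qed

lemma likelihood_le_of_far:
  assumes S_pd: "pos_def_mat q S" and X_dim: "X \<in> carrier_mat n p" and N_dim: "N \<in> carrier_mat n q"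
    and B0_dim: "B0 \<in> carrier_mat p q" and B_dim: "B \<in> carrier_mat p q"
    and info: "information_within S X a b" and a_nonneg: "a \<ge> 0" and \<epsilon>_pos: "\<epsilon> > 0"
    and score: "frob_norm (score S X N) \<le> a * \<epsilon> / 4" and far: "\<epsilon> < frob_norm (B - B0)"
  shows "mn_density (X * B) (1\<^sub>m n) S (X * B0 + N)
    \<le> mn_density (X * B0) (1\<^sub>m n) S (X * B0 + N) * exp (- (a * \<epsilon>\<^sup>2 / 4))"
proof -
  let ?D = "B - B0" and ?G = "score S X N"
  let ?x = "frob_norm ?D"
  have D_dim: "?D \<in> carrier_mat p q" using B0_dim by (rule minus_carrier_mat)
  have "frob_inner ?D ?G \<le> ?x * frob_norm ?G"
    using frob_inner_Cauchy_Schwarz[OF D_dim score_carrier[OF S_pd X_dim N_dim]] by linarith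
  also have "\<dots> \<le> ?x * (a * ?x / 4)"
    using score mult_left_mono[of \<epsilon> ?x a] far a_nonneg by (intro mult_left_mono) auto
  finally have "frob_inner ?D ?G \<le> a * ?x\<^sup>2 / 4"
    by (simp add: power2_eq_square mult_ac)
  moreover have "a * \<epsilon>\<^sup>2 \<le> a * ?x\<^sup>2"
    using a_nonneg far \<epsilon>_pos by (intro mult_left_mono power_mono) auto
  moreover have "a * ?x\<^sup>2 \<le> mahalanobis S (X * ?D)"
    using information_withinD(1)[OF S_pd X_dim info D_dim] .
  ultimately have "frob_inner ?D ?G - mahalanobis S (X * ?D) / 2 \<le> - (a * \<epsilon>\<^sup>2 / 4)"
    by linarith
  moreover have "mn_density (X * B0) (1\<^sub>m n) S (X * B0 + N) > 0"
    using X_dim B0_dim N_dim by (intro mn_density_pos[OF S_pd]) auto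
  ultimately show ?thesis
    unfolding likelihood_ratio[OF S_pd X_dim N_dim B0_dim B_dim] by (intro mult_left_mono) simp_all
qed

lemma likelihood_ge_of_near:
  assumes S_pd: "pos_def_mat q S" and X_dim: "X \<in> carrier_mat n p" and N_dim: "N \<in> carrier_mat n q"
    and B0_dim: "B0 \<in> carrier_mat p q" and B_dim: "B \<in> carrier_mat p q"
    and info: "information_within S X a b" and b_nonneg: "b \<ge> 0"
    and score: "frob_norm (score S X N) \<le> \<gamma>" and near: "frob_norm (B - B0) < r"
  shows "mn_density (X * B0) (1\<^sub>m n) S (X * B0 + N) * exp (- (\<gamma> * r + b * r\<^sup>2 / 2))
    \<le> mn_density (X * B) (1\<^sub>m n) S (X * B0 + N)"
proof -
  let ?D = "B - B0" and ?G = "score S X N"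
  have D_dim: "?D \<in> carrier_mat p q" using B0_dim by (rule minus_carrier_mat)
  have "\<bar>frob_inner ?D ?G\<bar> \<le> frob_norm ?D * frob_norm ?G"
    by (rule frob_inner_Cauchy_Schwarz[OF D_dim score_carrier[OF S_pd X_dim N_dim]])
  also have "\<dots> \<le> r * \<gamma>"
    using score near less_imp_le[OF le_less_trans[OF frob_norm_nonneg near]]
    by (intro mult_mono) auto
  finally have "- (\<gamma> * r) \<le> frob_inner ?D ?G" by (simp add: mult.commute)
  moreover have "b * (frob_norm ?D)\<^sup>2 \<le> b * r\<^sup>2"
    using b_nonneg near by (intro mult_left_mono power_mono) auto
  moreover have "mahalanobis S (X * ?D) \<le> b * (frob_norm ?D)\<^sup>2"
    using information_withinD(2)[OF S_pd X_dim info D_dim] .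
  ultimately have "- (\<gamma> * r + b * r\<^sup>2 / 2) \<le> frob_inner ?D ?G - mahalanobis S (X * ?D) / 2"
    by linarith
  moreover have "mn_density (X * B0) (1\<^sub>m n) S (X * B0 + N) > 0"
    using X_dim B0_dim N_dim by (intro mn_density_pos[OF S_pd]) auto
  ultimately show ?thesis
    unfolding likelihood_ratio[OF S_pd X_dim N_dim B0_dim B_dim] by (intro mult_left_mono) simp_all
qed

section \<open>Prior and posterior\<close>

abbreviation prior_ball_mass :: "nat \<Rightarrow> nat \<Rightarrow> (real mat \<Rightarrow> real) \<Rightarrow> real mat \<Rightarrow> real \<Rightarrow> real" where
  "prior_ball_mass p q prior B0 r \<equiv> measure (prior_measure p q prior)
     {B \<in> space (mat_space p q). frob_norm (B - B0) < r}"

lemma sets_prior_measure [simp]: "sets (prior_measure p q prior) = sets (mat_space p q)"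
  by (simp add: prior_measure_def)

lemma prob_space_prior_measure:
  assumes "prior \<in> borel_measurable (mat_space p q)"
    and "(\<integral>\<^sup>+ B. ennreal (prior B) \<partial>mat_space p q) = 1"
  shows "prob_space (prior_measure p q prior)"
proof (rule prob_spaceI)
  have "emeasure (prior_measure p q prior) (space (prior_measure p q prior))
      = (\<integral>\<^sup>+ B. ennreal (prior B) * indicator (space (mat_space p q)) B \<partial>mat_space p q)"
    using assms(1) unfolding prior_measure_def by (subst emeasure_density) auto
  also have "\<dots> = (\<integral>\<^sup>+ B. ennreal (prior B) \<partial>mat_space p q)"
    by (rule nn_integral_cong) simp
  finally show "emeasure (prior_measure p q prior) (space (prior_measure p q prior)) = 1"
    using assms(2) by simp
qed

lemma frob_dist_sets:
  assumes "B0 \<in> carrier_mat p q"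
  shows "{B \<in> space (mat_space p q). frob_norm (B - B0) < r} \<in> sets (mat_space p q)"
    and "{B \<in> space (mat_space p q). frob_norm (B - B0) > r} \<in> sets (mat_space p q)"
proof -
  have [measurable]: "(\<lambda>B. frob_norm (B - B0)) \<in> borel_measurable (mat_space p q)"
    by (intro measurable_frob_norm[of _ _ p q] measurable_mat_diff measurable_mat_const assms) simp
  show "{B \<in> space (mat_space p q). frob_norm (B - B0) < r} \<in> sets (mat_space p q)"
    "{B \<in> space (mat_space p q). frob_norm (B - B0) > r} \<in> sets (mat_space p q)"
    by measurable
qed

lemma prior_ball_mass_mono:
  assumes "prior \<in> borel_measurable (mat_space p q)"
    and "(\<integral>\<^sup>+ B. ennreal (prior B) \<partial>mat_space p q) = 1"
    and "B0 \<in> carrier_mat p q" and "r \<le> r'"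
  shows "prior_ball_mass p q prior B0 r \<le> prior_ball_mass p q prior B0 r'"
proof -
  interpret prob_space "prior_measure p q prior"
    using assms(1,2) by (rule prob_space_prior_measure)
  show ?thesis
    using frob_dist_sets(1)[OF assms(3)] assms(4) by (intro finite_measure_mono) auto
qed

lemma divide_left_mono_ennreal:
  fixes a b c :: ennreal
  assumes "b \<le> c"
  shows "a / c \<le> a / b"
proof -
  have "inverse c \<le> inverse b"
    using assms including ennreal.lifting by transfer (rule ereal_inverse_antimono)
  then show ?thesis
    unfolding divide_ennreal_def by (intro mult_left_mono) auto
qed

lemma measure_normalized_density_le:
  assumes "prob_space P" and lik_meas: "lik \<in> borel_measurable P"
    and upper: "S \<in> sets P" "\<And>x. x \<in> S \<Longrightarrow> lik x \<le> A"
    and lower: "U \<in> sets P" "\<And>x. x \<in> U \<Longrightarrow> b \<le> lik x"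
    and mass: "m \<le> measure P U" and pos: "A \<ge> 0" "b > 0" "m > 0"
  shows "measure (density P (\<lambda>x. ennreal (lik x) / (\<integral>\<^sup>+ x. ennreal (lik x) \<partial>P))) S \<le> A / (b * m)"
    (is "measure ?Q S \<le> _")
proof -
  interpret prob_space P by fact
  let ?Z = "\<integral>\<^sup>+ x. ennreal (lik x) \<partial>P"
  have "ennreal (b * m) \<le> ennreal b * emeasure P U"
    using mass pos by (simp add: emeasure_eq_measure ennreal_mult[symmetric])
  also have "\<dots> = (\<integral>\<^sup>+ x. ennreal b * indicator U x \<partial>P)"
    using lower(1) by (simp add: nn_integral_cmult_indicator)
  also have "\<dots> \<le> ?Z"
    using lower(2) by (intro nn_integral_mono) (auto simp: indicator_def intro!: ennreal_leI)
  finally have evidence: "ennreal (b * m) \<le> ?Z" .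
  have "emeasure ?Q S = (\<integral>\<^sup>+ x. ennreal (lik x) / ?Z * indicator S x \<partial>P)"
    using upper(1) lik_meas by (intro emeasure_density) auto
  also have "\<dots> \<le> (\<integral>\<^sup>+ x. ennreal A / ?Z \<partial>P)"
    using upper(2) by (intro nn_integral_mono)
      (auto simp: indicator_def intro!: ennreal_leI divide_right_mono_ennreal)
  also have "\<dots> = ennreal A / ?Z" by (simp add: emeasure_space_1)
  also have "\<dots> \<le> ennreal A / ennreal (b * m)"
    by (rule divide_left_mono_ennreal[OF evidence])
  also have "\<dots> = ennreal (A / (b * m))" using pos by (simp add: divide_ennreal)
  finally show ?thesis
    unfolding measure_def using pos by (intro enn2real_leI) auto
qed

lemma posterior_measure_eq_density:
  assumes "X \<in> carrier_mat n p"
  shows "posterior_measure X S q prior Y = density (prior_measure p q prior)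
    (\<lambda>B. ennreal (mn_density (X * B) (1\<^sub>m n) S Y)
      / (\<integral>\<^sup>+ B. ennreal (mn_density (X * B) (1\<^sub>m n) S Y) \<partial>prior_measure p q prior))"
  using assms by (simp add: posterior_measure_def Let_def)

lemma measurable_likelihood:
  assumes "pos_def_mat q S" "X \<in> carrier_mat n p" "Y \<in> carrier_mat n q"
  shows "(\<lambda>B. mn_density (X * B) (1\<^sub>m n) S Y) \<in> borel_measurable (prior_measure p q prior)"
  using assms
  by (intro measurable_mn_density[of q] measurable_mat_mult[of _ _ n p _ q] measurable_mat_const)
    (simp_all add: measurable_ident_sets)

lemma posterior_tail_bound:
  assumes S_pd: "pos_def_mat q S" and X_dim: "X \<in> carrier_mat n p"
    and B0_dim: "B0 \<in> carrier_mat p q"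
    and prior: "prior \<in> borel_measurable (mat_space p q)"
      "(\<integral>\<^sup>+ B. ennreal (prior B) \<partial>mat_space p q) = 1"
    and N_dim: "N \<in> carrier_mat n q" and info: "information_within S X a b"
    and nonneg: "a \<ge> 0" "b \<ge> 0" and \<epsilon>_pos: "\<epsilon> > 0" and score: "frob_norm (score S X N) \<le> a * \<epsilon> / 4"
    and ball: "m \<le> prior_ball_mass p q prior B0 r" and m_pos: "m > 0"
  shows "measure (posterior_measure X S q prior (X * B0 + N))
      {B \<in> space (mat_space p q). frob_norm (B - B0) > \<epsilon>}
    \<le> exp (- (a * \<epsilon>\<^sup>2 / 4) + (a * \<epsilon> / 4 * r + b * r\<^sup>2 / 2)) / m"
    (is "measure _ ?F \<le> exp (?l + ?u) / m")
proof -
  let ?lik = "\<lambda>B. mn_density (X * B) (1\<^sub>m n) S (X * B0 + N)"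
  have mean_dim: "X * B0 \<in> carrier_mat n q" "X * B0 + N \<in> carrier_mat n q"
    using X_dim B0_dim N_dim by auto
  have lik0_pos: "?lik B0 > 0" by (rule mn_density_pos[OF S_pd mean_dim])
  have far: "?lik B \<le> ?lik B0 * exp ?l" if "B \<in> ?F" for B
    using that
    by (intro likelihood_le_of_far[OF S_pd X_dim N_dim B0_dim _ info nonneg(1) \<epsilon>_pos score])
      (auto simp: space_mat_space)
  have near: "?lik B0 * exp (- ?u) \<le> ?lik B"
    if "B \<in> {B \<in> space (mat_space p q). frob_norm (B - B0) < r}" for B
    using that
    by (intro likelihood_ge_of_near[OF S_pd X_dim N_dim B0_dim _ info nonneg(2) score])
      (auto simp: space_mat_space)
  have "measure (posterior_measure X S q prior (X * B0 + N)) ?F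
      \<le> ?lik B0 * exp ?l / (?lik B0 * exp (- ?u) * m)"
    unfolding posterior_measure_eq_density[OF X_dim]
    by (intro measure_normalized_density_le[OF prob_space_prior_measure[OF prior]
          measurable_likelihood[OF S_pd X_dim mean_dim(2)] _ far _ near ball _ _ m_pos])
      (use lik0_pos frob_dist_sets[OF B0_dim] in simp_all)
  also have "?lik B0 * exp s / (?lik B0 * exp (- t) * m) = exp (s + t) / m" for s t
    using lik0_pos by (simp add: exp_add exp_minus field_simps)
  finally show ?thesis .
qed

section \<open>Posterior consistency\<close>

lemma information_within_eigenvalues:
  assumes S_pd: "pos_def_mat q S" and X_dim: "X \<in> carrier_mat n p" and n_pos: "n > 0"
    and gram_eigenvalues: "c1 \<le> lambda_min ((1 / real n) \<cdot>\<^sub>m (X\<^sup>T * X))"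
      "lambda_max ((1 / real n) \<cdot>\<^sub>m (X\<^sup>T * X)) \<le> c2"
    and S_eigenvalues: "0 < d1" "d1 \<le> lambda_min S" "lambda_max S \<le> d2" "0 < d2"
  shows "information_within S X (real n * (c1 / d2)) (real n * (c2 / d1))"
proof -
  have "rayleigh_within S d1 d2"
    using S_pd S_eigenvalues
    by (intro rayleigh_within_mono[OF rayleigh_within_lambda]) (auto simp: pos_def_mat_def)
  then have "rayleigh_within (mat_inv S) (1 / d2) (1 / d1)"
    using S_eigenvalues by (intro rayleigh_within_mat_inv[OF S_pd])
  then have "information_within S X (1 / d2 * (real n * c1)) (1 / d1 * (real n * c2))"
    using S_eigenvalues
    by (intro information_within_product[OF S_pd X_dim _ _ _
          rayleigh_within_gram[OF X_dim n_pos gram_eigenvalues]]) auto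
  then show ?thesis by simp
qed

lemma summable_power_smallo:
  fixes m :: "nat \<Rightarrow> nat"
  assumes m_smallo: "(\<lambda>n. real (m n)) \<in> o(\<lambda>n. real n)" and K_ge_1: "K \<ge> 1" and \<theta>_pos: "\<theta> > 0"
  shows "summable (\<lambda>n. K ^ m n * exp (- \<theta> * real n))"
proof (rule summable_comparison_test_ev)
  have ln_nonneg: "ln K \<ge> 0" using K_ge_1 by simp
  then have "eventually (\<lambda>n. norm (real (m n)) \<le> \<theta> / (2 * (ln K + 1)) * norm (real n)) sequentially"
    using \<theta>_pos by (intro landau_o.smallD[OF m_smallo]) simp
  then show "eventually (\<lambda>n. norm (K ^ m n * exp (- \<theta> * real n)) \<le> exp (- \<theta> / 2) ^ n) sequentially"
  proof eventually_elim
    case (elim n)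
    have "ln K * real (m n) \<le> (ln K + 1) * real (m n)" by (simp add: algebra_simps)
    also have "\<dots> \<le> \<theta> / 2 * real n" using elim ln_nonneg by (simp add: field_simps)
    finally have exponent: "real (m n) * ln K + - \<theta> * real n \<le> real n * (- \<theta> / 2)"
      by (simp add: mult.commute)
    have "exp (real (m n) * ln K) = K ^ m n"
      using K_ge_1 by (simp add: exp_of_nat_mult)
    then have "norm (K ^ m n * exp (- \<theta> * real n)) = exp (real (m n) * ln K + - \<theta> * real n)"
      using K_ge_1 unfolding exp_add by simp
    also have "\<dots> \<le> exp (real n * (- \<theta> / 2))"
      using exponent by (simp only: exp_le_cancel_iff)
    also have "\<dots> = exp (- \<theta> / 2) ^ n" by (rule exp_of_nat_mult)
    finally show ?case .
  qed
  show "summable (\<lambda>n. exp (- \<theta> / 2) ^ n)" using \<theta>_pos by (intro summable_geometric) simp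
qed

lemma AE_eventually_less_of_summable_tail:
  assumes "prob_space M" and meas: "\<And>n. n \<ge> n0 \<Longrightarrow> f n \<in> borel_measurable M"
    and tail: "eventually (\<lambda>n. measure M {\<omega> \<in> space M. t n \<le> f n \<omega>} \<le> u n) sequentially"
    and u_summable: "summable u"
  shows "AE \<omega> in M. eventually (\<lambda>n. f n \<omega> < (t n :: real)) sequentially"
proof -
  interpret prob_space M by fact
  define A where "A = (\<lambda>n. if n \<ge> n0 then {\<omega> \<in> space M. t n \<le> f n \<omega>} else {})"
  have A_sets: "A n \<in> sets M" for n
    using meas[of n] by (simp add: A_def)
  have "eventually (\<lambda>n. norm (measure M (A n)) \<le> u n) sequentially"
    using tail eventually_ge_at_top[of n0] by eventually_elim (simp add: A_def)
  then have "summable (\<lambda>n. measure M (A n))"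
    by (rule summable_comparison_test_ev) (rule u_summable)
  then have "AE \<omega> in M. eventually (\<lambda>n. \<omega> \<in> space M - A n) sequentially"
    by (intro borel_cantelli_AE1 A_sets) (auto simp: emeasure_eq_measure)
  then show ?thesis
  proof (rule AE_mp, intro AE_I2 impI)
    fix \<omega> assume "eventually (\<lambda>n. \<omega> \<in> space M - A n) sequentially"
    then show "eventually (\<lambda>n. f n \<omega> < t n) sequentially"
      using eventually_ge_at_top[of n0] by eventually_elim (auto simp: A_def)
  qed
qed

lemma AE_score_eventually_small:
  assumes S_pd: "pos_def_mat q S" and M_prob: "prob_space M"
    and noise: "\<And>n. n \<ge> 1 \<Longrightarrow>
      distributed M (mat_space n q) (E n) (\<lambda>Y. ennreal (mn_density (0\<^sub>m n q) (1\<^sub>m n) S Y))"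
    and X_dim: "\<And>n. n \<ge> 1 \<Longrightarrow> X n \<in> carrier_mat n (p n)"
    and info: "eventually (\<lambda>n. information_within S (X n) (real n * a) (real n * b)) sequentially"
    and p_smallo: "(\<lambda>n. real (p n)) \<in> o(\<lambda>n. real n)" and b_pos: "b > 0" and \<delta>_pos: "\<delta> > 0"
  shows "AE \<omega> in M. eventually (\<lambda>n. frob_norm (score S (X n) (E n \<omega>)) < real n * \<delta>) sequentially"
proof (rule AE_eventually_less_of_summable_tail[OF M_prob])
  let ?\<theta> = "\<delta>\<^sup>2 / (4 * b)"
  show "(\<lambda>\<omega>. frob_norm (score S (X n) (E n \<omega>))) \<in> borel_measurable M" if "n \<ge> 1" for n
    by (rule measurable_frob_norm[OF measurable_score[OF S_pd X_dim[OF that]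
        distributed_measurable[OF noise[OF that]]]])
  show "eventually (\<lambda>n. measure M {\<omega> \<in> space M. real n * \<delta> \<le> frob_norm (score S (X n) (E n \<omega>))}
      \<le> sqrt 2 ^ (p n * q) * exp (- ?\<theta> * real n)) sequentially"
    using info eventually_ge_at_top[of 1]
  proof eventually_elim
    case (elim n)
    have "- (real n * \<delta>)\<^sup>2 / (4 * (real n * b)) = - ?\<theta> * real n"
      using elim(2) by (simp add: power2_eq_square)
    then show ?case
      using score_norm_tail[OF S_pd M_prob noise[OF elim(2)] X_dim[OF elim(2)] elim(1),
          of "real n * \<delta>"] elim(2) b_pos \<delta>_pos
      by simp
  qed
  have "(\<lambda>n. real (p n * q)) \<in> o(\<lambda>n. real n)"
    using landau_o.small.mult_right[OF p_smallo] p_smallo by (cases "q = 0") simp_all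
  then show "summable (\<lambda>n. sqrt 2 ^ (p n * q) * exp (- ?\<theta> * real n))"
    using b_pos \<delta>_pos by (intro summable_power_smallo) auto
qed

lemma posterior_tail_tendsto_zero:
  assumes S_pd: "pos_def_mat q S" and X_dim: "\<And>n. n \<ge> 1 \<Longrightarrow> X n \<in> carrier_mat n (p n)"
    and B0_dim: "\<And>n. n \<ge> 1 \<Longrightarrow> B0 n \<in> carrier_mat (p n) q"
    and prior: "\<And>n. n \<ge> 1 \<Longrightarrow> prior n \<in> borel_measurable (mat_space (p n) q)"
      "\<And>n. n \<ge> 1 \<Longrightarrow> (\<integral>\<^sup>+ B. ennreal (prior n B) \<partial>mat_space (p n) q) = 1"
    and N_dim: "\<And>n. n \<ge> 1 \<Longrightarrow> N n \<in> carrier_mat n q"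
    and info: "eventually (\<lambda>n. information_within S (X n) (real n * a) (real n * b)) sequentially"
    and a_pos: "a > 0" and b_nonneg: "b \<ge> 0" and \<epsilon>_pos: "\<epsilon> > 0"
    and score: "eventually (\<lambda>n.
      frob_norm (score S (X n) (N n)) < real n * (a * \<epsilon> / 4)) sequentially"
    and mass: "\<And>r k. 0 < r \<Longrightarrow> 0 < k \<Longrightarrow>
      eventually (\<lambda>n. exp (- k * real n) < prior_ball_mass (p n) q (prior n) (B0 n) r) sequentially"
  shows "(\<lambda>n. measure (posterior_measure (X n) S q (prior n) (X n * B0 n + N n))
      {B \<in> space (mat_space (p n) q). frob_norm (B - B0 n) > \<epsilon>}) \<longlonglongrightarrow> 0"
    (is "?post \<longlonglongrightarrow> 0")
proof -
  define \<eta> where "\<eta> = a * \<epsilon>\<^sup>2 / 16"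
  have \<eta>_pos: "\<eta> > 0" using a_pos \<epsilon>_pos by (simp add: \<eta>_def)
  have "((\<lambda>r. a * \<epsilon> / 4 * r + b * r\<^sup>2 / 2) \<longlongrightarrow> 0) (at_right 0)"
    by (auto intro!: tendsto_eq_intros)
  then have "eventually (\<lambda>r. a * \<epsilon> / 4 * r + b * r\<^sup>2 / 2 < \<eta> \<and> r > 0) (at_right 0)"
    using order_tendstoD(2) \<eta>_pos by (intro eventually_conj eventually_at_right_less) blast
  then obtain r where r: "a * \<epsilon> / 4 * r + b * r\<^sup>2 / 2 < \<eta>" "r > 0"
    using eventually_happens'[of "at_right (0 :: real)"] by auto
  have "eventually (\<lambda>n. norm (?post n) \<le> exp (- \<eta>) ^ n) sequentially"
    using mass[OF r(2) \<eta>_pos] info score eventually_ge_at_top[of 1]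
  proof eventually_elim
    case (elim n)
    note n_ge_1 = elim(4)
    have "?post n \<le> exp (- (real n * a * \<epsilon>\<^sup>2 / 4) + (real n * a * \<epsilon> / 4 * r + real n * b * r\<^sup>2 / 2))
        / exp (- \<eta> * real n)"
      using elim a_pos b_nonneg
      by (intro posterior_tail_bound[OF S_pd X_dim[OF n_ge_1] B0_dim[OF n_ge_1] prior(1)[OF n_ge_1]
          prior(2)[OF n_ge_1] N_dim[OF n_ge_1] _ _ _ \<epsilon>_pos])
        (auto simp: mult.assoc)
    also have "\<dots> = exp (real n * (- 4 * \<eta> + (a * \<epsilon> / 4 * r + b * r\<^sup>2 / 2) + \<eta>))"
      by (simp add: exp_diff[symmetric] \<eta>_def algebra_simps)
    also have "\<dots> \<le> exp (real n * - \<eta>)"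
      using r(1) \<eta>_pos unfolding exp_le_cancel_iff by (intro mult_left_mono) auto
    finally show ?case
      by (simp only: exp_of_nat_mult real_norm_def abs_of_nonneg[OF measure_nonneg])
  qed
  moreover have "(\<lambda>n. exp (- \<eta>) ^ n) \<longlonglongrightarrow> 0"
    using \<eta>_pos by (intro LIMSEQ_power_zero) simp
  ultimately show ?thesis by (rule Lim_null_comparison)
qed

theorem posterior_consistency:
  assumes S_pd: "pos_def_mat q S" and M_prob: "prob_space M"
    and noise: "\<And>n. n \<ge> 1 \<Longrightarrow>
      distributed M (mat_space n q) (E n) (\<lambda>Y. ennreal (mn_density (0\<^sub>m n q) (1\<^sub>m n) S Y))"
    and X_dim: "\<And>n. n \<ge> 1 \<Longrightarrow> X n \<in> carrier_mat n (p n)"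
    and B0_dim: "\<And>n. n \<ge> 1 \<Longrightarrow> B0 n \<in> carrier_mat (p n) q"
    and prior: "\<And>n. n \<ge> 1 \<Longrightarrow> prior n \<in> borel_measurable (mat_space (p n) q)"
      "\<And>n. n \<ge> 1 \<Longrightarrow> (\<integral>\<^sup>+ B. ennreal (prior n B) \<partial>mat_space (p n) q) = 1"
    and p_smallo: "(\<lambda>n. real (p n)) \<in> o(\<lambda>n. real n)"
    and info: "eventually (\<lambda>n. information_within S (X n) (real n * a) (real n * b)) sequentially"
    and a_pos: "a > 0" and b_pos: "b > 0" and \<epsilon>_pos: "\<epsilon> > 0"
    and mass: "\<And>r k. 0 < r \<Longrightarrow> 0 < k \<Longrightarrow>
      eventually (\<lambda>n. exp (- k * real n) < prior_ball_mass (p n) q (prior n) (B0 n) r) sequentially"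
  shows "AE \<omega> in M.
     (\<lambda>n. measure (posterior_measure (X n) S q (prior n) (X n * B0 n + E n \<omega>))
            {B \<in> space (mat_space (p n) q). frob_norm (B - B0 n) > \<epsilon>}) \<longlonglongrightarrow> 0"
proof -
  have "AE \<omega> in M. eventually (\<lambda>n.
      frob_norm (score S (X n) (E n \<omega>)) < real n * (a * \<epsilon> / 4)) sequentially"
    using a_pos \<epsilon>_pos
    by (intro AE_score_eventually_small[OF S_pd M_prob noise X_dim info p_smallo b_pos]) auto
  then show ?thesis
    using AE_space
  proof eventually_elim
    case (elim \<omega>)
    have "E n \<omega> \<in> carrier_mat n q" if "n \<ge> 1" for n
      by (rule measurable_mat_spaceD(1)[OF distributed_measurable[OF noise[OF that]] elim(2)])
    then show ?case
      using a_pos b_pos elim(1) mass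
      by (intro posterior_tail_tendsto_zero[OF S_pd X_dim B0_dim prior _ info _ _ \<epsilon>_pos]) auto
  qed
qed

lemma eventually_ball_mass_gt_exp:
  fixes mass :: "nat \<Rightarrow> real \<Rightarrow> real"
  assumes mono: "\<And>n r r'. n \<ge> 1 \<Longrightarrow> r \<le> r' \<Longrightarrow> mass n r \<le> mass n r'"
    and \<Delta>\<^sub>0_pos: "\<Delta>\<^sub>0 > 0" and \<kappa>_pos: "\<And>\<Delta>. 0 < \<Delta> \<Longrightarrow> \<Delta> < \<Delta>\<^sub>0 \<Longrightarrow> 0 < \<kappa> \<Delta>" and s_nonneg: "s \<ge> 0"
    and shrinking: "\<And>\<Delta> k. 0 < \<Delta> \<Longrightarrow> \<Delta> < \<Delta>\<^sub>0 \<Longrightarrow> 0 < k \<Longrightarrow> k < \<kappa> \<Delta> \<Longrightarrow>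
      eventually (\<lambda>n. exp (- k * real n) < mass n (\<Delta> / real n powr s)) sequentially"
    and r_pos: "r > 0" and k_pos: "k > 0"
  shows "eventually (\<lambda>n. exp (- k * real n) < mass n r) sequentially"
proof -
  define \<Delta> where "\<Delta> = min r (\<Delta>\<^sub>0 / 2)"
  have \<Delta>: "0 < \<Delta>" "\<Delta> < \<Delta>\<^sub>0" "\<Delta> \<le> r" using r_pos \<Delta>\<^sub>0_pos by (auto simp: \<Delta>_def)
  define k' where "k' = min k (\<kappa> \<Delta> / 2)"
  have k': "0 < k'" "k' < \<kappa> \<Delta>" "k' \<le> k" using k_pos \<kappa>_pos[OF \<Delta>(1,2)] by (auto simp: k'_def)
  show ?thesis
    using shrinking[OF \<Delta>(1,2) k'(1,2)] eventually_ge_at_top[of 1]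
  proof eventually_elim
    case (elim n)
    have "real n powr s \<ge> 1" using elim(2) s_nonneg by (intro ge_one_powr_ge_zero) auto
    then have "\<Delta> / real n powr s \<le> r"
      using \<Delta> frac_le[of \<Delta> \<Delta> 1 "real n powr s"] by simp
    then have "mass n (\<Delta> / real n powr s) \<le> mass n r" using elim(2) by (intro mono)
    moreover have "exp (- k * real n) \<le> exp (- k' * real n)"
      using k'(3) by (simp add: mult_right_mono)
    ultimately show ?case using elim(1) by linarith
  qed
qed

theorem theorem1:
  fixes q :: nat and \<Sigma> :: "real mat"
    and p :: "nat \<Rightarrow> nat" and X :: "nat \<Rightarrow> real mat" and B0 :: "nat \<Rightarrow> real mat"
    and \<pi> :: "nat \<Rightarrow> real mat \<Rightarrow> real"
    and M :: "'w measure" and E :: "nat \<Rightarrow> 'w \<Rightarrow> real mat"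
    and c1 c2 d1 d2 \<epsilon> \<rho> :: real
  assumes q_pos: "q \<ge> 1"
    and Sigma_pd: "pos_def_mat q \<Sigma>"
    and X_dim: "\<And>n. n \<ge> 1 \<Longrightarrow> X n \<in> carrier_mat n (p n)"
    and B0_dim: "\<And>n. n \<ge> 1 \<Longrightarrow> B0 n \<in> carrier_mat (p n) q"
    and prior_meas: "\<And>n. n \<ge> 1 \<Longrightarrow> \<pi> n \<in> borel_measurable (mat_space (p n) q)"
    and prior_nonneg: "\<And>n B. n \<ge> 1 \<Longrightarrow> \<pi> n B \<ge> 0"
    and prior_norm: "\<And>n. n \<ge> 1 \<Longrightarrow> (\<integral>\<^sup>+ B. ennreal (\<pi> n B) \<partial>mat_space (p n) q) = 1"
    and prob: "prob_space M"
    and noise: "\<And>n. n \<ge> 1 \<Longrightarrow>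
       distributed M (mat_space n q) (E n) (\<lambda>Y. ennreal (mn_density (0\<^sub>m n q) (1\<^sub>m n) \<Sigma> Y))"
    and A1_o: "(\<lambda>n. real (p n)) \<in> o(\<lambda>n. real n)"
    and A1_le: "\<And>n. n \<ge> 1 \<Longrightarrow> p n \<le> n"
    and A2: "0 < c1"
      "ereal c1 < liminf (\<lambda>n. ereal (lambda_min ((1 / real n) \<cdot>\<^sub>m (transpose_mat (X n) * X n))))"
      "liminf (\<lambda>n. ereal (lambda_min ((1 / real n) \<cdot>\<^sub>m (transpose_mat (X n) * X n))))
         \<le> limsup (\<lambda>n. ereal (lambda_max ((1 / real n) \<cdot>\<^sub>m (transpose_mat (X n) * X n))))"
      "limsup (\<lambda>n. ereal (lambda_max ((1 / real n) \<cdot>\<^sub>m (transpose_mat (X n) * X n)))) < ereal c2"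
    and A3: "0 < d1" "d1 < lambda_min \<Sigma>" "lambda_min \<Sigma> \<le> lambda_max \<Sigma>"
      "lambda_max \<Sigma> < d2"
    and eps_pos: "\<epsilon> > 0"
    and rho_pos: "\<rho> > 0"
    and prior_mass: "\<And>\<Delta> k. 0 < \<Delta> \<Longrightarrow>
       \<Delta> < \<epsilon>^2 * c1 * sqrt d1 / (48 * sqrt c2 * d2) \<Longrightarrow>
       0 < k \<Longrightarrow> k < \<epsilon>^2 * c1 / (32 * d2) - 3 * \<Delta> * sqrt c2 / (2 * sqrt d1) \<Longrightarrow>
       eventually (\<lambda>n. measure (prior_measure (p n) q (\<pi> n))
            {B \<in> space (mat_space (p n) q). frob_norm (B - B0 n) < \<Delta> / real n powr (\<rho> / 2)}
          > exp (- k * real n)) sequentially"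
  shows "AE \<omega> in M.
     (\<lambda>n. measure (posterior_measure (X n) \<Sigma> q (\<pi> n) (X n * B0 n + E n \<omega>))
            {B \<in> space (mat_space (p n) q). frob_norm (B - B0 n) > \<epsilon>}) \<longlonglongrightarrow> 0"
proof (rule posterior_consistency[OF Sigma_pd prob noise X_dim B0_dim prior_meas prior_norm A1_o
      _ _ _ eps_pos])
  have "ereal c1 < ereal c2"
    using less_le_trans[OF A2(2,3)] A2(4) by (rule less_trans)
  then have c2_pos: "c2 > 0" using A2(1) by simp
  have d2_pos: "d2 > 0" using A3 by linarith
  show "c1 / d2 > 0" "c2 / d1 > 0"
    using A2(1) A3(1) c2_pos d2_pos by simp_all
  show "eventually (\<lambda>n.
      information_within \<Sigma> (X n) (real n * (c1 / d2)) (real n * (c2 / d1))) sequentially"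
    using less_LiminfD[OF A2(2)] Limsup_lessD[OF A2(4)] eventually_ge_at_top[of 1]
    by eventually_elim
      (intro information_within_eigenvalues[OF Sigma_pd X_dim]; use A3 d2_pos in simp)
  let ?mass = "\<lambda>n. prior_ball_mass (p n) q (\<pi> n) (B0 n)"
  let ?\<Delta>\<^sub>0 = "\<epsilon>\<^sup>2 * c1 * sqrt d1 / (48 * sqrt c2 * d2)"
  let ?\<kappa> = "\<lambda>\<Delta>. \<epsilon>\<^sup>2 * c1 / (32 * d2) - 3 * \<Delta> * sqrt c2 / (2 * sqrt d1)"
  have mono: "?mass n r \<le> ?mass n r'" if "n \<ge> 1" "r \<le> r'" for n r r'
    using that by (intro prior_ball_mass_mono prior_meas prior_norm B0_dim)
  have "?\<Delta>\<^sub>0 > 0" using eps_pos A2(1) A3(1) c2_pos d2_pos by simp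
  moreover have "0 < ?\<kappa> \<Delta>" if "\<Delta> < ?\<Delta>\<^sub>0" for \<Delta>
    using that A3(1) c2_pos d2_pos by (simp add: field_simps)
  ultimately show "eventually (\<lambda>n. exp (- k * real n) < ?mass n r) sequentially"
    if "r > 0" "k > 0" for r k
    using rho_pos by (intro eventually_ball_mass_gt_exp[where mass = ?mass and \<Delta>\<^sub>0 = ?\<Delta>\<^sub>0
          and \<kappa> = ?\<kappa> and s = "\<rho> / 2", OF mono _ _ _ prior_mass that]) simp_all
qed

end
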